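(* Let $X$ be a finite connected graph such that the valency at each vertex $x$, denoted by $k_x+1$, is at least $3$. Then there is a unique normalized length distance $d$ on $X$ (i.e. $d\in\Delta(X)$) minimizing the volume entropy $h_{\mathrm{vol}}(d)$ among all $d\in\Delta(X)$. The minimal volume entropy is $$h_{\min}=\frac12\sum_{x\in VX}(k_x+1)\log k_x,$$ and the entropy-minimizing length distance $d=d_\ell$ is given by $$\ell(e)=\frac{\log\bigl(k_{i(e)}k_{t(e)}\bigr)}{\sum_{x\in VX}(k_x+1)\log k_x}\qquad\text{for all } e\in EX.$$
   Context: Graphs: $VX$ is the set of vertices of $X$ and $EX$ the set of oriented edges; each $e\in EX$ has an initial vertex $i(e)$, a terminal vertex $t(e)$ and a reversed edge $\bar e\neq e$ with $\bar{\bar e}=e$, $i(\bar e)=t(e)$; an unoriented edge is a pair $\{e,\bar e\}$. Loops and multiple edges are allowed. The valency of $x$ is the number of $e\in EX$ with $i(e)=x$. The geometric realization is also denoted $X$. Length distances: given positive reals $\ell(e)=\ell(\bar e)$ for $e\in EX$, the length distance $d=d_\ell$ on $X$ is the maximal distance which makes each half-edge of an edge $e$ containing a vertex isometric to $[0,\ell(e)/2]$ (so each edge $e$ has length $\ell(e)$ and $d_\ell$ is the path metric). The volume is $\mathrm{vol}(X,d_\ell)=\frac12\sum_{e\in EX}\ell(e)$. $\Delta(X)$ denotes the set of all length distances $d=d_\ell$ on $X$ normalized so that $\mathrm{vol}(X,d)=1$. Volume entropy: let $\tilde X\to X$ be a universal covering tree with the lifted distance. For a connected subset $S\subset\tilde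 X$, $\ell(S)$ is the sum of the lengths of the (maximal pieces of) edges in $S$. Then $h_{\mathrm{vol}}(d)=\limsup_{r\to\infty}\frac1r\log \ell(B(x_0,r))$, where $B(x_0,r)$ is the ball of radius $r$ centered at a fixed vertex $x_0$ of $\tilde X$ (this is independent of $x_0$). *)

theory Defs
  imports "HOL-Analysis.Analysis" "Graph_Theory.Graph_Theory"
begin

text \<open>
  A graph in the sense of Serre (oriented edges, a fixed-point free reversal \<open>bar\<close>, loops and
  multiple edges allowed) is a \<^term>\<open>bidirected_digraph G bar\<close>; the initial and terminal vertex of
  an edge are its tail and head, and the valency of \<open>x\<close> is \<^term>\<open>out_degree G x\<close>.
\<close>

section \<open>Geometric realization\<close>

text \<open>
  Points of the realization are vertices or interior points of edges. The point at parameter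
  \<open>s\<close> on \<open>e\<close> is the point at parameter \<open>1 - s\<close> on the reversed edge, so an interior point
  is represented by the pair of its two parametrizations. The realization is thus independent of
  the edge lengths, and distances for different lengths are functions on the same space.
\<close>

datatype ('a, 'b) point = Vertex 'a | Interior "('b \<times> real) set"

definition edge_point ::
  "('a, 'b) pre_digraph \<Rightarrow> ('b \<Rightarrow> 'b) \<Rightarrow> 'b \<Rightarrow> real \<Rightarrow> ('a, 'b) point" where
  "edge_point G bar e s =
     (if s = 0 then Vertex (tail G e)
      else if s = 1 then Vertex (head G e)
      else Interior {(e, s), (bar e, 1 - s)})"

definition realization :: "('a, 'b) pre_digraph \<Rightarrow> ('b \<Rightarrow> 'b) \<Rightarrow> ('a, 'b) point set" where
  "realization G bar =
     Vertex ` verts G \<union> {edge_point G bar e s | e s. e \<in> arcs G \<and> 0 \<le> s \<and> s \<le> 1}"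


section \<open>Length distances\<close>

definition edge_length_system ::
  "('a, 'b) pre_digraph \<Rightarrow> ('b \<Rightarrow> 'b) \<Rightarrow> ('b \<Rightarrow> real) \<Rightarrow> bool" where
  "edge_length_system G bar l \<longleftrightarrow> (\<forall>e\<in>arcs G. 0 < l e \<and> l (bar e) = l e)"

text \<open>
  Distances making each half-edge isometric to \<open>[0, l e / 2]\<close>. A function on points is
  required to vanish off the realization, so that it is determined by its values there.
\<close>

definition half_edge_distance ::
  "('a, 'b) pre_digraph \<Rightarrow> ('b \<Rightarrow> 'b) \<Rightarrow> ('b \<Rightarrow> real) \<Rightarrow>
   (('a, 'b) point \<Rightarrow> ('a, 'b) point \<Rightarrow> real) \<Rightarrow> bool" where
  "half_edge_distance G bar l d \<longleftrightarrow>
     Metric_space (realization G bar) d \<and>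
     (\<forall>P Q. P \<notin> realization G bar \<or> Q \<notin> realization G bar \<longrightarrow> d P Q = 0) \<and>
     (\<forall>e\<in>arcs G. \<forall>s\<in>{0..1/2}. \<forall>t\<in>{0..1/2}.
        d (edge_point G bar e s) (edge_point G bar e t) = l e * \<bar>s - t\<bar>)"

text \<open>The order on functions is the pointwise one, so this is the maximal such distance.\<close>

definition length_distance ::
  "('a, 'b) pre_digraph \<Rightarrow> ('b \<Rightarrow> 'b) \<Rightarrow> ('b \<Rightarrow> real) \<Rightarrow>
   ('a, 'b) point \<Rightarrow> ('a, 'b) point \<Rightarrow> real" where
  "length_distance G bar l = (GREATEST d. half_edge_distance G bar l d)"

definition volume :: "('a, 'b) pre_digraph \<Rightarrow> ('b \<Rightarrow> real) \<Rightarrow> real" where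
  "volume G l = (\<Sum>e\<in>arcs G. l e) / 2"

definition normalized_length_distances ::
  "('a, 'b) pre_digraph \<Rightarrow> ('b \<Rightarrow> 'b) \<Rightarrow>
   (('a, 'b) point \<Rightarrow> ('a, 'b) point \<Rightarrow> real) set" where
  "normalized_length_distances G bar =
     {length_distance G bar l | l. edge_length_system G bar l \<and> volume G l = 1}"

text \<open>
  The length of an edge with respect to a length distance, recovered as twice the length of a
  half-edge. (The distance between the two ends of \<open>e\<close> would not do: it may be
  shorter than \<open>e\<close>.)
\<close>

definition edge_length ::
  "('a, 'b) pre_digraph \<Rightarrow> ('b \<Rightarrow> 'b) \<Rightarrow>
   (('a, 'b) point \<Rightarrow> ('a, 'b) point \<Rightarrow> real) \<Rightarrow> 'b \<Rightarrow> real" where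
  "edge_length G bar d e = 2 * d (edge_point G bar e 0) (edge_point G bar e (1/2))"


section \<open>Universal covering trees\<close>

definition reduced :: "('b \<Rightarrow> 'b) \<Rightarrow> 'b list \<Rightarrow> bool" where
  "reduced bar p \<longleftrightarrow> successively (\<lambda>a b. b \<noteq> bar a) p"

text \<open>
  A tree is a connected graph without nontrivial reduced closed walks. The predicate
  \<^const>\<open>Digraph_Component.tree\<close> is not usable here, because it counts \<open>[e, bar e]\<close> as a cycle.
\<close>

definition undirected_tree :: "('a, 'b) pre_digraph \<Rightarrow> ('b \<Rightarrow> 'b) \<Rightarrow> bool" where
  "undirected_tree G bar \<longleftrightarrow>
     bidirected_digraph G bar \<and> Digraph_Component.connected G \<and>
     (\<forall>v p. pre_digraph.awalk G v p v \<and> reduced bar p \<longrightarrow> p = [])"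

definition graph_covering ::
  "('c, 'd) pre_digraph \<Rightarrow> ('d \<Rightarrow> 'd) \<Rightarrow> ('a, 'b) pre_digraph \<Rightarrow> ('b \<Rightarrow> 'b) \<Rightarrow>
   ('c \<Rightarrow> 'a) \<Rightarrow> ('d \<Rightarrow> 'b) \<Rightarrow> bool" where
  "graph_covering T barT X barX pv pe \<longleftrightarrow>
     pv ` verts T = verts X \<and>
     (\<forall>a\<in>arcs T. pe a \<in> arcs X \<and> tail X (pe a) = pv (tail T a) \<and>
        head X (pe a) = pv (head T a) \<and> pe (barT a) = barX (pe a)) \<and>
     (\<forall>y\<in>verts T. bij_betw pe (out_arcs T y) (out_arcs X (pv y)))"

definition universal_covering_tree ::
  "('c, 'd) pre_digraph \<Rightarrow> ('d \<Rightarrow> 'd) \<Rightarrow> ('a, 'b) pre_digraph \<Rightarrow> ('b \<Rightarrow> 'b) \<Rightarrow>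
   ('c \<Rightarrow> 'a) \<Rightarrow> ('d \<Rightarrow> 'b) \<Rightarrow> bool" where
  "universal_covering_tree T barT X barX pv pe \<longleftrightarrow>
     undirected_tree T barT \<and> graph_covering T barT X barX pv pe"

subsection \<open>Existence\<close>

text \<open>
  The usual construction: vertices are the reduced walks issuing from \<open>x0\<close>, stored with
  their last edge first.
\<close>

fun walk_end :: "('a, 'b) pre_digraph \<Rightarrow> 'a \<Rightarrow> 'b list \<Rightarrow> 'a" where
  "walk_end X x0 [] = x0"
| "walk_end X x0 (e # w) = head X e"

fun reduced_walk :: "('a, 'b) pre_digraph \<Rightarrow> ('b \<Rightarrow> 'b) \<Rightarrow> 'a \<Rightarrow> 'b list \<Rightarrow> bool" where
  "reduced_walk X bar x0 [] = True"
| "reduced_walk X bar x0 (e # w) \<longleftrightarrow>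
     e \<in> arcs X \<and> tail X e = walk_end X x0 w \<and> reduced_walk X bar x0 w \<and>
     (w \<noteq> [] \<longrightarrow> e \<noteq> bar (hd w))"

definition walk_step :: "('b \<Rightarrow> 'b) \<Rightarrow> 'b list \<Rightarrow> 'b \<Rightarrow> 'b list" where
  "walk_step bar w e = (if w \<noteq> [] \<and> e = bar (hd w) then tl w else e # w)"

definition walk_tree ::
  "('a, 'b) pre_digraph \<Rightarrow> ('b \<Rightarrow> 'b) \<Rightarrow> 'a \<Rightarrow> ('b list, 'b list \<times> 'b) pre_digraph" where
  "walk_tree X bar x0 =
     \<lparr> verts = {w. reduced_walk X bar x0 w},
       arcs = {(w, e). reduced_walk X bar x0 w \<and> e \<in> arcs X \<and> tail X e = walk_end X x0 w},
       tail = fst,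
       head = (\<lambda>(w, e). walk_step bar w e) \<rparr>"

lemma walk_tree_simps:
  "w \<in> verts (walk_tree X bar x0) \<longleftrightarrow> reduced_walk X bar x0 w"
  "(w, e) \<in> arcs (walk_tree X bar x0) \<longleftrightarrow>
     reduced_walk X bar x0 w \<and> e \<in> arcs X \<and> tail X e = walk_end X x0 w"
  "tail (walk_tree X bar x0) a = fst a"
  "head (walk_tree X bar x0) a = walk_step bar (fst a) (snd a)"
  by (simp_all add: walk_tree_def split_beta)

definition walk_tree_bar ::
  "('a, 'b) pre_digraph \<Rightarrow> ('b \<Rightarrow> 'b) \<Rightarrow> 'a \<Rightarrow> 'b list \<times> 'b \<Rightarrow> 'b list \<times> 'b" where
  "walk_tree_bar X bar x0 a =
     (if a \<in> arcs (walk_tree X bar x0) then (walk_step bar (fst a) (snd a), bar (snd a)) else a)"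

context bidirected_digraph
begin

lemma walk_end_in_verts:
  "x0 \<in> verts G \<Longrightarrow> reduced_walk G arev x0 w \<Longrightarrow> walk_end G x0 w \<in> verts G"
  by (cases w) auto

lemma walk_step_props:
  assumes "reduced_walk G arev x0 w" "e \<in> arcs G" "tail G e = walk_end G x0 w"
  shows "reduced_walk G arev x0 (walk_step arev w e)"
    and "walk_end G x0 (walk_step arev w e) = head G e"
    and "walk_step arev (walk_step arev w e) (arev e) = w"
proof -
  show "reduced_walk G arev x0 (walk_step arev w e)"
    using assms by (cases w) (auto simp: walk_step_def)
  show "walk_end G x0 (walk_step arev w e) = head G e"
    using assms by (cases w) (auto simp: walk_step_def)
  show "walk_step arev (walk_step arev w e) (arev e) = w"
    using assms by (cases w; cases "tl w") (auto simp: walk_step_def)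
qed

lemma bidirected_walk_tree:
  assumes "x0 \<in> verts G"
  shows "bidirected_digraph (walk_tree G arev x0) (walk_tree_bar G arev x0)"
proof -
  let ?T = "walk_tree G arev x0" and ?b = "walk_tree_bar G arev x0"
  interpret T: wf_digraph ?T
    by unfold_locales (auto simp: walk_tree_simps intro: walk_step_props(1))
  have closed: "?b a \<in> arcs ?T" if "a \<in> arcs ?T" for a
    using that by (cases a) (auto simp: walk_tree_bar_def walk_tree_simps walk_step_props)
  show ?thesis
  proof (rule T.bidirected_digraphI)
    fix a assume a: "a \<in> arcs ?T"
    show "?b a \<noteq> a"
      using a arev_neq by (cases a) (auto simp: walk_tree_bar_def walk_tree_simps)
    show "?b (?b a) = a"
      using a closed[OF a]
      by (cases a) (auto simp: walk_tree_bar_def walk_tree_simps walk_step_props)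
    show "tail ?T (?b a) = head ?T a"
      using a by (cases a) (auto simp: walk_tree_bar_def walk_tree_simps)
  qed (auto simp: walk_tree_bar_def)
qed

lemma connected_walk_tree:
  assumes "x0 \<in> verts G"
  shows "Digraph_Component.connected (walk_tree G arev x0)"
proof -
  let ?T = "walk_tree G arev x0"
  interpret T: bidirected_digraph ?T "walk_tree_bar G arev x0"
    using assms by (rule bidirected_walk_tree)
  have sym: "symmetric ?T"
    unfolding symmetric_conv by (metis T.arev_in_arcs T.tail_arev T.head_arev)
  have reach: "[] \<rightarrow>\<^sup>*\<^bsub>?T\<^esub> w" if "reduced_walk G arev x0 w" for w
    using that
  proof (induction w)
    case Nil
    then show ?case by (auto simp: walk_tree_simps)
  next
    case (Cons e w)
    have "(w, e) \<in> arcs ?T" "head ?T (w, e) = e # w" "tail ?T (w, e) = w"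
      using Cons.prems by (auto simp: walk_tree_simps walk_step_def)
    then have "w \<rightarrow>\<^bsub>?T\<^esub> (e # w)"
      by (metis T.in_arcs_imp_in_arcs_ends)
    moreover have "[] \<rightarrow>\<^sup>*\<^bsub>?T\<^esub> w" using Cons by simp
    ultimately show ?case by (meson T.reachable_adj_trans)
  qed
  have v: "verts ?T = {w. reduced_walk G arev x0 w}" by (auto simp: walk_tree_simps)
  have "u \<rightarrow>\<^sup>*\<^bsub>?T\<^esub> w" if "u \<in> verts ?T" "w \<in> verts ?T" for u w
    using that reach symmetric_reachable[OF sym] v
    by (metis T.reachable_trans mem_Collect_eq)
  moreover have "verts ?T \<noteq> {}" unfolding v by (auto intro: exI[of _ "[]"])
  ultimately show ?thesis
    unfolding Digraph_Component.connected_def strongly_connected_def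
    using T.reachable_mk_symmetricI by auto
qed


lemma walk_tree_ascends:
  assumes "x0 \<in> verts G"
    and "pre_digraph.awalk (walk_tree G arev x0) u p v"
    and "reduced (walk_tree_bar G arev x0) p" and "p \<noteq> []"
    and "hd p = (w, e)" "walk_step arev w e = e # w"
  shows "length u < length v \<and> (\<exists>w' e'. last p = (w', e') \<and> walk_step arev w' e' = e' # w')"
  using assms(2-)
proof (induction p arbitrary: u w e)
  case Nil
  then show ?case by simp
next
  case (Cons a p)
  let ?T = "walk_tree G arev x0"
  interpret T: bidirected_digraph ?T "walk_tree_bar G arev x0"
    using assms(1) by (rule bidirected_walk_tree)
  have a: "a = (w, e)" using Cons.prems by simp
  have aw: "a \<in> arcs ?T" "u = w" "T.awalk (e # w) p v"
    using Cons.prems by (auto simp: T.awalk_Cons_iff a walk_tree_simps)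
  show ?case
  proof (cases p)
    case Nil
    then have "v = e # w" using aw by (simp add: T.awalk_Nil_iff)
    then show ?thesis using aw(2) Cons.prems(5) Nil by (simp add: a)
  next
    case (Cons b q)
    obtain e' where b: "b = (e # w, e')"
      using aw(3) Cons by (cases b) (auto simp: T.awalk_Cons_iff walk_tree_simps)
    have "b \<noteq> walk_tree_bar G arev x0 a"
      using Cons.prems(2) Cons by (auto simp: reduced_def)
    then have "e' \<noteq> arev e"
      using aw(1) Cons.prems(5) by (auto simp: walk_tree_bar_def a b)
    then have "walk_step arev (e # w) e' = e' # e # w" by (simp add: walk_step_def)
    then have "length (e # w) < length v \<and>
        (\<exists>w' e'. last p = (w', e') \<and> walk_step arev w' e' = e' # w')"
      using Cons.IH[OF aw(3), of "e # w" e'] Cons.prems(2) b local.Cons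
      by (auto simp: reduced_def)
    then show ?thesis using aw(2) local.Cons by auto
  qed
qed

lemma walk_tree_descends:
  assumes "x0 \<in> verts G"
    and "pre_digraph.awalk (walk_tree G arev x0) u p v"
    and "reduced (walk_tree_bar G arev x0) p" and "p \<noteq> []"
    and "last p = (w, e)" "walk_step arev w e \<noteq> e # w"
  shows "length v < length u"
  using assms(2-5)
proof (induction p arbitrary: u)
  case Nil
  then show ?case by simp
next
  case (Cons a p)
  let ?T = "walk_tree G arev x0"
  interpret T: bidirected_digraph ?T "walk_tree_bar G arev x0"
    using assms(1) by (rule bidirected_walk_tree)
  obtain w1 e1 where a: "a = (w1, e1)" by (cases a)
  have aw: "u = w1" "T.awalk (walk_step arev w1 e1) p v"
    using Cons.prems by (auto simp: T.awalk_Cons_iff a walk_tree_simps)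
  have "walk_step arev w1 e1 \<noteq> e1 # w1"
    using walk_tree_ascends[OF assms(1) Cons.prems(1-3), of w1 e1] a Cons.prems(4) assms(6)
    by auto
  then have w1: "w1 \<noteq> []" "walk_step arev w1 e1 = tl w1"
    by (auto simp: walk_step_def split: if_splits)
  show ?case
  proof (cases "p = []")
    case True
    then have "v = tl w1" using aw w1 by (simp add: T.awalk_Nil_iff)
    then show ?thesis using aw(1) w1(1) by simp
  next
    case False
    then have "length v < length (walk_step arev w1 e1)"
      using Cons.IH[OF aw(2)] Cons.prems by (auto simp: reduced_def successively_Cons)
    then show ?thesis using aw w1 by simp
  qed
qed

lemma walk_tree_no_circuit:
  assumes "x0 \<in> verts G"
    and "pre_digraph.awalk (walk_tree G arev x0) v p v"
    and "reduced (walk_tree_bar G arev x0) p"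
  shows "p = []"
  using assms(2-)
proof (induction "length p" arbitrary: p v rule: less_induct)
  case less
  let ?T = "walk_tree G arev x0"
  interpret T: bidirected_digraph ?T "walk_tree_bar G arev x0"
    using assms(1) by (rule bidirected_walk_tree)
  show ?case
  proof (rule ccontr)
    assume ne: "p \<noteq> []"
    obtain w e where h: "hd p = (w, e)" by (cases "hd p")
    obtain w' e' where l: "last p = (w', e')" by (cases "last p")
    have d: "walk_step arev w e \<noteq> e # w"
      using walk_tree_ascends[OF assms(1) less.prems ne h] by auto
    have u: "walk_step arev w' e' = e' # w'"
      using walk_tree_descends[OF assms(1) less.prems ne l] by auto
    have "length p \<noteq> 1" using h l d u by (cases p) auto
    then obtain q where p: "p = (w, e) # q @ [(w', e')]"
      using ne h l by (cases p; cases "tl p" rule: rev_cases) auto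
    have w: "w \<noteq> []" "e = arev (hd w)" "walk_step arev w e = tl w"
      using d by (auto simp: walk_step_def split: if_splits)
    have awq: "T.awalk (tl w) q w'" and v: "v = w" "v = e' # w'" and arc: "(w', e') \<in> arcs ?T"
      using less.prems(1) u w unfolding p
      by (auto simp: T.awalk_Cons_iff T.awalk_Nil_iff walk_tree_simps)
    then have "T.awalk w' q w'" by (metis list.sel(3))
    moreover have "reduced (walk_tree_bar G arev x0) q"
      using less.prems(2) unfolding p reduced_def
      by (auto simp: successively_Cons successively_append_iff)
    ultimately have "q = []" using less.hyps[of q] p by simp
    have "walk_tree_bar G arev x0 (w', e') = (w, e)"
      using arc u v w by (simp add: walk_tree_bar_def, metis list.sel(1))
    then have "walk_tree_bar G arev x0 (w, e) = (w', e')" by (metis T.arev_arev)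
    then show False using less.prems(2) \<open>q = []\<close> by (simp add: p reduced_def)
  qed
qed

lemma walk_end_surj:
  assumes "x0 \<rightarrow>\<^sup>*\<^bsub>G\<^esub> x"
  shows "\<exists>w. reduced_walk G arev x0 w \<and> walk_end G x0 w = x"
  using assms
proof (induction rule: reachable_induct)
  case base
  show ?case by (rule exI[of _ "[]"]) simp
next
  case (step x y)
  obtain e where "e \<in> arcs G" "tail G e = x" "head G e = y"
    using step.hyps by (auto elim: reachableE)
    moreover obtain w where "reduced_walk G arev x0 w" "walk_end G x0 w = x"
    using step.IH by blast
  ultimately show ?case by (intro exI[of _ "walk_step arev w e"]) (simp add: walk_step_props)
qed

lemma universal_covering_tree_walk_tree:
  assumes "Digraph_Component.connected G" "x0 \<in> verts G"
  shows "universal_covering_tree (walk_tree G arev x0) (walk_tree_bar G arev x0) G arev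
           (walk_end G x0) snd"
proof -
  have sym: "symmetric G"
    unfolding symmetric_conv by (metis arev_in_arcs tail_arev head_arev)
  have reach: "x0 \<rightarrow>\<^sup>*\<^bsub>G\<^esub> x" if "x \<in> verts G" for x
    using assms that reachable_mk_symmetric_eq[OF sym]
    unfolding Digraph_Component.connected_def strongly_connected_def by auto
  have "walk_end G x0 ` verts (walk_tree G arev x0) = verts G"
  proof (intro equalityI subsetI)
    fix x assume "x \<in> walk_end G x0 ` verts (walk_tree G arev x0)"
    then show "x \<in> verts G" using walk_end_in_verts[OF assms(2)] by (auto simp: walk_tree_simps)
  next
    fix x assume "x \<in> verts G"
    then obtain w where "reduced_walk G arev x0 w" "walk_end G x0 w = x"
      using walk_end_surj[OF reach] by blast
    then show "x \<in> walk_end G x0 ` verts (walk_tree G arev x0)"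
      by (auto simp: walk_tree_simps)
  qed
  moreover have "bij_betw snd (out_arcs (walk_tree G arev x0) w) (out_arcs G (walk_end G x0 w))"
    if "w \<in> verts (walk_tree G arev x0)" for w
    using that by (auto simp: walk_tree_simps out_arcs_def bij_betw_def inj_on_def image_iff)
  ultimately have "graph_covering (walk_tree G arev x0) (walk_tree_bar G arev x0) G arev
           (walk_end G x0) snd"
    unfolding graph_covering_def
    by (auto simp: walk_tree_simps walk_step_props walk_tree_bar_def)
  then show ?thesis
    unfolding universal_covering_tree_def undirected_tree_def
    using bidirected_walk_tree connected_walk_tree walk_tree_no_circuit assms by auto
qed

end


section \<open>Volume entropy\<close>

text \<open>
  The total length of the part of the edges lying in \<open>S\<close>; the sum over oriented edges counts
  every edge twice. On a ball of a locally finite graph with edge lengths bounded below, only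
  finitely many terms are nonzero.
\<close>

definition total_length ::
  "('a, 'b) pre_digraph \<Rightarrow> ('b \<Rightarrow> 'b) \<Rightarrow> ('b \<Rightarrow> real) \<Rightarrow> ('a, 'b) point set \<Rightarrow> real" where
  "total_length G bar l S =
     (\<Sum>\<^sub>\<infinity>e\<in>arcs G. measure lborel {t\<in>{0..l e}. edge_point G bar e (t / l e) \<in> S}) / 2"

definition ball_length ::
  "('a, 'b) pre_digraph \<Rightarrow> ('b \<Rightarrow> 'b) \<Rightarrow> ('b \<Rightarrow> real) \<Rightarrow> 'a \<Rightarrow> real \<Rightarrow> real" where
  "ball_length G bar l x r =
     total_length G bar l
       (Metric_space.mball (realization G bar) (length_distance G bar l) (Vertex x) r)"

text \<open>
  The entropy of a length distance \<open>d\<close> on \<open>X\<close>, computed in a covering tree \<open>T\<close> with covering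
  map \<open>pe\<close> on edges: every edge of \<open>T\<close> has the length of its image with respect to \<open>d\<close>.
\<close>

definition volume_entropy ::
  "('a, 'b) pre_digraph \<Rightarrow> ('b \<Rightarrow> 'b) \<Rightarrow> ('c, 'd) pre_digraph \<Rightarrow> ('d \<Rightarrow> 'd) \<Rightarrow> ('d \<Rightarrow> 'b) \<Rightarrow> 'c \<Rightarrow>
   (('a, 'b) point \<Rightarrow> ('a, 'b) point \<Rightarrow> real) \<Rightarrow> ereal" where
  "volume_entropy X barX T barT pe x0 d =
     Limsup at_top
       (\<lambda>r::real. ereal (ln (ball_length T barT (\<lambda>a. edge_length X barX d (pe a)) x0 r) / r))"

end

theory Submission
  imports Defs
begin

text \<open>
  The volume entropy is the critical exponent of the Poincare series: the sum of
  \<open>exp (- s * length)\<close> over the reduced walks of the universal covering tree converges for \<open>s\<close> above the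
  entropy, and its convergence for \<open>s\<close> bounds the entropy by \<open>s\<close> (\<open>walk_sum_bounded\<close>, \<open>entropy_le\<close>). Both
  directions compare the length of a ball with the number of reduced walks that fit into it, and
  so rest on a description of the length distance by walks (\<open>length_distance_eq\<close>,
  \<open>distance_walk_le\<close>, \<open>walk_of_distance_less\<close>). Reduced walks of the tree project to those of \<open>X\<close>
  (\<open>walk_sum_covering\<close>), which turns the series into a positive function \<open>z\<close> on the finitely many
  oriented edges of \<open>X\<close> with
  \<open>(\<Sum>f. exp (- s * l f) * z f) \<le> z e\<close>, where \<open>f\<close> runs over the edges that may follow \<open>e\<close> (\<open>supersolution\<close>).

  The lower bound compares this inequality with the non-backtracking random walk, which moves
  from \<open>e\<close> to each of the \<open>k (head X e)\<close> following edges with equal probability and for which the uniform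
  measure on oriented edges is stationary. Taking logarithms, using \<open>1 + t \<le> exp t\<close>, and
  averaging over the stationary measure, \<open>z\<close> drops out and \<open>S \<le> 2 * s\<close> remains, where \<open>S\<close> is the sum of
  \<open>(k x + 1) * ln (k x)\<close> over the vertices (\<open>sum_excess_le\<close>). In dynamical terms, the entropy of this
  walk divided by its mean step length is \<open>S / 2\<close> whatever the normalized lengths are, and it never
  exceeds the topological entropy.

  If the entropy equals \<open>S / 2\<close>, all the inequalities become equalities in the limit \<open>s \<rightarrow> S / 2\<close>: the
  weights \<open>exp (- s * l f) * z f / z e\<close> tend to \<open>1 / k (head X e)\<close>. Eliminating \<open>z\<close>, which is possible because every edge is
  followed by at least two others, gives \<open>S * l f = ln (k (tail X f) * k (head X f))\<close> (\<open>equality_case\<close>). For these lengths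
  the square root of \<open>k (head X e)\<close> is an exact solution at \<open>S / 2\<close>, so that the series converges geometrically
  above \<open>S / 2\<close> and the bound is attained (\<open>optimal_walk_sum_le\<close>).
\<close>

section \<open>The length distance as a supremum over Lipschitz functions\<close>

text \<open>
  The graph may be an infinite tree; the uniform lower bound \<open>m\<close> on the edge lengths keeps distinct
  vertices at positive distance, and lets only walks with few edges fit into a ball.
\<close>

locale metric_graph = bidirected_digraph G bar
  for G :: "('a, 'b) pre_digraph" and bar :: "'b \<Rightarrow> 'b" +
  fixes l :: "'b \<Rightarrow> real" and m :: real
  assumes connected_graph: "Digraph_Component.connected G"
    and m_pos: "0 < m"
    and m_le: "e \<in> arcs G \<Longrightarrow> m \<le> l e"
    and l_bar: "e \<in> arcs G \<Longrightarrow> l (bar e) = l e"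
begin

abbreviation pt :: "'b \<Rightarrow> real \<Rightarrow> ('a, 'b) point" where
  "pt \<equiv> edge_point G bar"

abbreviation R :: "('a, 'b) point set" where
  "R \<equiv> realization G bar"

abbreviation wlen :: "'b list \<Rightarrow> real" where
  "wlen p \<equiv> sum_list (map l p)"

lemma l_pos: "e \<in> arcs G \<Longrightarrow> 0 < l e"
  using m_pos m_le by fastforce

lemma wlen_ge: "set p \<subseteq> arcs G \<Longrightarrow> m * length p \<le> wlen p"
  by (induction p) (auto simp: algebra_simps dest: m_le)

lemma wlen_nonneg: "set p \<subseteq> arcs G \<Longrightarrow> 0 \<le> wlen p"
  using wlen_ge[of p] m_pos by (smt (verit) mult_nonneg_nonneg of_nat_0_le_iff)

lemma pt_simps [simp]:
  "pt e 0 = Vertex (tail G e)" "pt e 1 = Vertex (head G e)"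
  by (simp_all add: edge_point_def)

lemma pt_interior: "0 < s \<Longrightarrow> s < 1 \<Longrightarrow> pt e s = Interior {(e, s), (bar e, 1 - s)}"
  by (simp add: edge_point_def)

lemma Vertex_in_R: "v \<in> verts G \<Longrightarrow> Vertex v \<in> R"
  by (simp add: realization_def)

lemma pt_in_R: "e \<in> arcs G \<Longrightarrow> 0 \<le> s \<Longrightarrow> s \<le> 1 \<Longrightarrow> pt e s \<in> R"
  by (auto simp: realization_def)

lemma R_cases:
  assumes "P \<in> R"
  obtains v where "v \<in> verts G" "P = Vertex v"
  | e s where "e \<in> arcs G" "0 < s" "s < 1" "P = pt e s"
proof -
  consider v where "v \<in> verts G" "P = Vertex v"
    | e s where "e \<in> arcs G" "0 \<le> s" "s \<le> 1" "P = pt e s"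
    using assms by (auto simp: realization_def)
  then show ?thesis
  proof cases
    case (2 e s)
    show ?thesis
    proof (cases "s = 0 \<or> s = 1")
      case True
      then show ?thesis using 2 that(1)[of "tail G e"] that(1)[of "head G e"] by auto
    next
      case False
      then show ?thesis using 2 by (intro that(2)[of e s]) auto
    qed
  qed (rule that(1))
qed

lemma obtain_walk:
  assumes "u \<in> verts G" "v \<in> verts G"
  obtains p where "awalk u p v"
proof -
  have "u \<rightarrow>\<^sup>*\<^bsub>mk_symmetric G\<^esub> v"
    using connected_graph assms
    by (simp add: Digraph_Component.connected_def strongly_connected_def)
  then show ?thesis
    unfolding reachable_mk_symmetric_eq[OF sym_arcs] reachable_awalk by (elim exE) (rule that)
qed

text \<open>
  A dual description of the path metric: the largest distance compatible with the edge lengths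
  is the supremum of \<open>\<bar>f P - f Q\<bar>\<close> over all functions that are 1-Lipschitz along every edge. Upper bounds
  then follow by adding up edges, lower bounds by exhibiting one function, and no shortest path
  through interior points ever has to be chosen.
\<close>

definition edge_lipschitz :: "(('a, 'b) point \<Rightarrow> real) \<Rightarrow> bool" where
  "edge_lipschitz f \<longleftrightarrow>
     (\<forall>e\<in>arcs G. \<forall>s\<in>{0..1}. \<forall>t\<in>{0..1}. \<bar>f (pt e s) - f (pt e t)\<bar> \<le> l e * \<bar>s - t\<bar>)"

definition lipschitz_distance :: "('a, 'b) point \<Rightarrow> ('a, 'b) point \<Rightarrow> real" where
  "lipschitz_distance P Q =
     (if P \<in> R \<and> Q \<in> R then SUP f\<in>Collect edge_lipschitz. \<bar>f P - f Q\<bar> else 0)"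

lemma edge_lipschitzD:
  assumes "edge_lipschitz f" "e \<in> arcs G" "0 \<le> s" "s \<le> 1" "0 \<le> t" "t \<le> 1"
  shows "\<bar>f (pt e s) - f (pt e t)\<bar> \<le> l e * \<bar>s - t\<bar>"
  using assms unfolding edge_lipschitz_def by (meson atLeastAtMost_iff)

lemma edge_lipschitz_zero: "edge_lipschitz (\<lambda>P. 0)"
  by (simp add: edge_lipschitz_def l_pos less_imp_le)

lemma edge_lipschitz_walk:
  assumes "edge_lipschitz f" "awalk u p v"
  shows "\<bar>f (Vertex u) - f (Vertex v)\<bar> \<le> wlen p"
  using assms(2)
proof (induction p arbitrary: u)
  case Nil
  then show ?case by (simp add: awalk_Nil_iff)
next
  case (Cons e p)
  then have e: "e \<in> arcs G" "u = tail G e" "awalk (head G e) p v"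
    by (auto simp: awalk_Cons_iff)
  then have "\<bar>f (Vertex u) - f (Vertex (head G e))\<bar> \<le> l e"
    using edge_lipschitzD[OF assms(1) e(1), of 0 1] by simp
  with Cons.IH[OF e(3)] show ?case by simp
qed

lemma edge_lipschitz_tail:
  assumes "edge_lipschitz f" "e \<in> arcs G" "0 \<le> s" "s \<le> 1"
  shows "\<bar>f (Vertex (tail G e)) - f (pt e s)\<bar> \<le> l e"
proof -
  have "\<bar>f (Vertex (tail G e)) - f (pt e s)\<bar> \<le> l e * s"
    using edge_lipschitzD[OF assms(1,2), of 0 s] assms by simp
  also have "\<dots> \<le> l e" using assms l_pos[of e] by (simp add: mult_left_le)
  finally show ?thesis .
qed

text \<open>
  Connectedness makes the supremum finite: \<open>f\<close> cannot vary by more than the length of a walk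
  joining \<open>P\<close> to \<open>Q\<close>.
\<close>

lemma edge_lipschitz_bounded:
  assumes "P \<in> R" "Q \<in> R"
  shows "\<exists>C. \<forall>f. edge_lipschitz f \<longrightarrow> \<bar>f P - f Q\<bar> \<le> C"
proof -
  have near: "\<exists>u\<in>verts G. \<exists>C. \<forall>f. edge_lipschitz f \<longrightarrow> \<bar>f (Vertex u) - f P\<bar> \<le> C" if "P \<in> R" for P
    using that
  proof (cases rule: R_cases)
    case (1 v)
    then show ?thesis by (intro bexI[of _ v] exI[of _ 0] allI impI) simp_all
  next
    case (2 e s)
    then show ?thesis
      by (intro bexI[of _ "tail G e"] exI[of _ "l e"] allI impI)
        (simp_all add: edge_lipschitz_tail)
  qed
  obtain u C where u: "u \<in> verts G"
      and C: "\<forall>f. edge_lipschitz f \<longrightarrow> \<bar>f (Vertex u) - f P\<bar> \<le> C"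
    using near[OF assms(1)] by (elim bexE exE)
  obtain v D where v: "v \<in> verts G"
      and D: "\<forall>f. edge_lipschitz f \<longrightarrow> \<bar>f (Vertex v) - f Q\<bar> \<le> D"
    using near[OF assms(2)] by (elim bexE exE)
  obtain p where p: "awalk u p v" using obtain_walk[OF u v] .
  show ?thesis
  proof (intro exI allI impI)
    fix f assume f: "edge_lipschitz f"
    show "\<bar>f P - f Q\<bar> \<le> C + wlen p + D"
      using C[rule_format, OF f] D[rule_format, OF f] edge_lipschitz_walk[OF f p] by linarith
  qed
qed

lemma bdd_lipschitz:
  assumes "P \<in> R" "Q \<in> R"
  shows "bdd_above ((\<lambda>f. \<bar>f P - f Q\<bar>) ` Collect edge_lipschitz)"
proof -
  obtain C where C: "\<forall>f. edge_lipschitz f \<longrightarrow> \<bar>f P - f Q\<bar> \<le> C"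
    using edge_lipschitz_bounded[OF assms] by (elim exE)
  show ?thesis by (rule bdd_aboveI2[of _ _ C]) (rule C[rule_format], erule CollectD)
qed

lemma lipschitz_distance_ge:
  assumes "edge_lipschitz f" "P \<in> R" "Q \<in> R"
  shows "\<bar>f P - f Q\<bar> \<le> lipschitz_distance P Q"
proof -
  have "f \<in> Collect edge_lipschitz" using assms(1) by simp
  then have "\<bar>f P - f Q\<bar> \<le> (SUP f\<in>Collect edge_lipschitz. \<bar>f P - f Q\<bar>)"
    using bdd_lipschitz[OF assms(2,3)] by (rule cSUP_upper[where f = "\<lambda>f. \<bar>f P - f Q\<bar>"])
  then show ?thesis using assms(2,3) by (simp only: lipschitz_distance_def simp_thms if_True)
qed

lemma lipschitz_distance_le:
  assumes "P \<in> R" "Q \<in> R" "\<And>f. edge_lipschitz f \<Longrightarrow> \<bar>f P - f Q\<bar> \<le> C"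
  shows "lipschitz_distance P Q \<le> C"
proof -
  have "(SUP f\<in>Collect edge_lipschitz. \<bar>f P - f Q\<bar>) \<le> C"
  proof (rule cSUP_least)
    show "Collect edge_lipschitz \<noteq> {}" using edge_lipschitz_zero by blast
  qed (rule assms(3), erule CollectD)
  then show ?thesis using assms(1,2) by (simp only: lipschitz_distance_def simp_thms if_True)
qed

text \<open>
  A function \<open>g\<close> on the vertices is extended to an edge by entering it from the cheaper end. The
  point is stored together with both of its parametrizations, and the minimum over the two pairs
  is exactly the minimum over the two ends.
\<close>

definition extend :: "('a \<Rightarrow> real) \<Rightarrow> ('a, 'b) point \<Rightarrow> real" where
  "extend g P = (case P of Vertex v \<Rightarrow> g v
     | Interior Z \<Rightarrow> Min ((\<lambda>(e, s). g (tail G e) + s * l e) ` Z))"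

lemma extend_Vertex [simp]: "extend g (Vertex v) = g v"
  by (simp add: extend_def)

lemma extend_pt:
  assumes "e \<in> arcs G" "0 \<le> s" "s \<le> 1" "\<bar>g (tail G e) - g (head G e)\<bar> \<le> l e"
  shows "extend g (pt e s) = min (g (tail G e) + s * l e) (g (head G e) + (1 - s) * l e)"
proof -
  consider "s = 0" | "s = 1" | "0 < s" "s < 1" using assms by fastforce
  then show ?thesis
  proof cases
    case 3
    then show ?thesis using assms by (simp add: extend_def pt_interior l_bar)
  qed (use assms in auto)
qed

lemma edge_lipschitz_extend:
  assumes "\<And>e. e \<in> arcs G \<Longrightarrow> \<bar>g (tail G e) - g (head G e)\<bar> \<le> l e"
  shows "edge_lipschitz (extend g)"
  unfolding edge_lipschitz_def
proof (intro ballI)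
  fix e s t assume e: "e \<in> arcs G" and st: "s \<in> {0..1::real}" "t \<in> {0..1::real}"
  have a: "\<bar>min a b - min c d\<bar> \<le> r" if "\<bar>a - c\<bar> \<le> r" "\<bar>b - d\<bar> \<le> r" for a b c d r :: real
    using that by linarith
  have b: "\<bar>l e * x - l e * y\<bar> = l e * \<bar>x - y\<bar>" for x y
    using l_pos[OF e] by (simp add: abs_mult flip: right_diff_distrib)
  have "\<bar>extend g (pt e s) - extend g (pt e t)\<bar> =
     \<bar>min (g (tail G e) + s * l e) (g (head G e) + (1 - s) * l e) -
      min (g (tail G e) + t * l e) (g (head G e) + (1 - t) * l e)\<bar>"
    using extend_pt[OF e _ _ assms[OF e]] st by simp
  also have "\<dots> \<le> l e * \<bar>s - t\<bar>"
    by (rule a) (use b[of s t] b[of "1-s" "1-t"] in \<open>simp_all add: mult.commute abs_minus_commute\<close>)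
  finally show "\<bar>extend g (pt e s) - extend g (pt e t)\<bar> \<le> l e * \<bar>s - t\<bar>" .
qed

text \<open>
  A tent of height \<open>r\<close> supported around the point at parameter \<open>t\<close> of the single edge \<open>e\<close>. It separates
  an interior point from every other point; extensions from the vertices cannot do this on a
  loop, where they are symmetric in \<open>s\<close> and \<open>1 - s\<close>.
\<close>

definition bump :: "'b \<Rightarrow> real \<Rightarrow> real \<Rightarrow> ('a, 'b) point \<Rightarrow> real" where
  "bump e t r P = (case P of Vertex v \<Rightarrow> 0
     | Interior Z \<Rightarrow> if e \<in> fst ` Z then max 0 (r - l e * \<bar>(THE s. (e, s) \<in> Z) - t\<bar>) else 0)"

lemma bump_pt:
  assumes "e \<in> arcs G" "e' \<in> arcs G" "0 \<le> s" "s \<le> 1" "r \<le> l e * t" "r \<le> l e * (1 - t)"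
  shows "bump e t r (pt e' s) =
    (if e' = e then max 0 (r - l e * \<bar>s - t\<bar>)
     else if e' = bar e then max 0 (r - l e * \<bar>1 - s - t\<bar>) else 0)"
proof -
  have ends: "r - l e * \<bar>0 - t\<bar> \<le> 0" "r - l e * \<bar>1 - t\<bar> \<le> 0" 
    using assms l_pos[OF assms(1)] by (smt (verit) mult_minus_right mult_left_mono)+
  consider "s = 0" | "s = 1" | "0 < s" "s < 1" using assms by fastforce
  then show ?thesis
  proof cases
    case 3
    have ne: "bar e' \<noteq> e'" "bar e \<noteq> e" using arev_neq assms by blast+
    have inv: "e = bar e' \<longleftrightarrow> e' = bar e" by auto
    have "(THE x. (e', x) \<in> {(e', s), (bar e', 1 - s)}) = s"
      "(THE x. (bar e', x) \<in> {(e', s), (bar e', 1 - s)}) = 1 - s"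
      using ne by auto
    then show ?thesis
      using 3 ne inv by (auto simp: bump_def pt_interior)
  qed (use ends in \<open>auto simp: bump_def\<close>)
qed

lemma edge_lipschitz_bump:
  assumes "e \<in> arcs G" "r \<le> l e * t" "r \<le> l e * (1 - t)"
  shows "edge_lipschitz (bump e t r)"
  unfolding edge_lipschitz_def
proof (intro ballI)
  fix e' s u assume e': "e' \<in> arcs G" and su: "s \<in> {0..1::real}" "u \<in> {0..1::real}"
  have b: "\<bar>max 0 (r - l e * x) - max 0 (r - l e * y)\<bar> \<le> l e * \<bar>s - u\<bar>"
    if "\<bar>x - y\<bar> \<le> \<bar>s - u\<bar>" for x y
  proof -
    have "\<bar>max 0 (r - l e * x) - max 0 (r - l e * y)\<bar> \<le> \<bar>l e * x - l e * y\<bar>" by linarith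
    also have "\<dots> = l e * \<bar>x - y\<bar>"
      using l_pos[OF assms(1)] by (simp add: abs_mult flip: right_diff_distrib)
    also have "\<dots> \<le> l e * \<bar>s - u\<bar>" using that l_pos[OF assms(1)] by simp
    finally show ?thesis .
  qed
  show "\<bar>bump e t r (pt e' s) - bump e t r (pt e' u)\<bar> \<le> l e' * \<bar>s - u\<bar>"
  proof (cases "e' = e \<or> e' = bar e")
    case True
    then show ?thesis
      using su b l_bar[OF assms(1)] arev_neq[OF assms(1)]
      by (auto simp: bump_pt[OF assms(1) e' _ _ assms(2,3)] intro!: b)
  next
    case False
    then show ?thesis
      using su l_pos[OF e'] by (auto simp: bump_pt[OF assms(1) e' _ _ assms(2,3)])
  qed
qed

lemma separated:
  assumes "P \<in> R" "Q \<in> R" "P \<noteq> Q"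
  shows "\<exists>f. edge_lipschitz f \<and> f P \<noteq> f Q"
proof -
  have interior: "\<exists>f. edge_lipschitz f \<and> f P \<noteq> f Q"
    if e: "e \<in> arcs G" "0 < t" "t < 1" "P = pt e t" and Q: "Q \<in> R" "P \<noteq> Q" for e t P Q
  proof -
    define r where "r = l e * min t (1 - t)"
    have r: "0 < r" "r \<le> l e * t" "r \<le> l e * (1 - t)"
      using l_pos[OF e(1)] e unfolding r_def by auto
    have P: "bump e t r P = r" using e r by (simp add: bump_pt)
    have "bump e t r Q < r"
      using Q(1)
    proof (cases rule: R_cases)
      case (1 v)
      then show ?thesis using r by (simp add: bump_def)
    next
      case (2 e' s)
      have "s \<noteq> t" if "e' = e" using that 2 Q e by auto
      moreover have "1 - s \<noteq> t" if "e' = bar e"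
        using that 2 Q e by (auto simp: pt_interior insert_commute)
      ultimately show ?thesis
        using 2 r l_pos[OF e(1)] e by (auto simp: bump_pt)
    qed
    then show ?thesis using P edge_lipschitz_bump[OF e(1) r(2,3)] by (metis less_irrefl)
  qed
  from assms(1) show ?thesis
  proof (cases rule: R_cases)
    case (2 e s)
    then show ?thesis using interior assms by blast
  next
    case P: (1 u)
    from assms(2) show ?thesis
    proof (cases rule: R_cases)
      case (2 e s)
      then show ?thesis using interior assms by metis
    next
      case (1 v)
      have "edge_lipschitz (extend (\<lambda>w. if w = u then m else 0))"
        using m_le m_pos by (intro edge_lipschitz_extend) (auto simp: abs_if intro: less_imp_le[OF l_pos])
      moreover have "extend (\<lambda>w. if w = u then m else 0) P \<noteq> extend (\<lambda>w. if w = u then m else 0) Q"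
        using P 1 assms m_pos by auto
      ultimately show ?thesis by blast
    qed
  qed
qed

lemma metric_space_lipschitz: "Metric_space R lipschitz_distance"
proof
  show nn: "0 \<le> lipschitz_distance P Q" for P Q
    using lipschitz_distance_ge[OF edge_lipschitz_zero, of P Q]
    by (cases "P \<in> R \<and> Q \<in> R") (auto simp: lipschitz_distance_def)
  show "lipschitz_distance P Q = lipschitz_distance Q P" for P Q
    by (auto simp: lipschitz_distance_def abs_minus_commute)
  show "lipschitz_distance P Q = 0 \<longleftrightarrow> P = Q" if PQ: "P \<in> R" "Q \<in> R" for P Q
  proof
    assume z: "lipschitz_distance P Q = 0"
    show "P = Q"
    proof (rule ccontr)
      assume "P \<noteq> Q"
      then obtain f where "edge_lipschitz f" "f P \<noteq> f Q" using separated PQ by blast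
      then show False using lipschitz_distance_ge[of f P Q] PQ z by simp
    qed
  next
    assume "P = Q"
    then have "lipschitz_distance P Q \<le> 0" using PQ by (intro lipschitz_distance_le) auto
    then show "lipschitz_distance P Q = 0" using nn[of P Q] by simp
  qed
  show "lipschitz_distance P S \<le> lipschitz_distance P Q + lipschitz_distance Q S"
    if "P \<in> R" "Q \<in> R" "S \<in> R" for P Q S
  proof (rule lipschitz_distance_le)
    fix f assume f: "edge_lipschitz f"
    show "\<bar>f P - f S\<bar> \<le> lipschitz_distance P Q + lipschitz_distance Q S"
      using lipschitz_distance_ge[OF f, of P Q] lipschitz_distance_ge[OF f, of Q S] that by linarith
  qed (use that in auto)
qed

text \<open>
  The extension of the zero function is \<open>l e * min s (1 - s)\<close> on every edge, which has full slope on
  each half-edge and hence realizes the prescribed distances.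
\<close>

lemma half_edge_lipschitz: "half_edge_distance G bar l lipschitz_distance"
  unfolding half_edge_distance_def
proof (intro conjI ballI allI impI)
  show "Metric_space R lipschitz_distance" by (rule metric_space_lipschitz)
  show "lipschitz_distance P Q = 0" if "P \<notin> R \<or> Q \<notin> R" for P Q
    using that by (auto simp: lipschitz_distance_def)
  fix e s t assume e: "e \<in> arcs G" and st: "s \<in> {0..1/2::real}" "t \<in> {0..1/2::real}"
  have R: "pt e s \<in> R" "pt e t \<in> R" using e st by (auto intro!: pt_in_R)
  have c: "edge_lipschitz (extend (\<lambda>_. 0))"
    by (intro edge_lipschitz_extend) (simp add: less_imp_le l_pos)
  have v: "extend (\<lambda>_. 0) (pt e x) = l e * x" if "x \<in> {0..1/2}" for x
    using that e l_pos[OF e] by (auto simp: extend_pt min_def mult.commute)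
  have "l e * \<bar>s - t\<bar> = \<bar>extend (\<lambda>_. 0) (pt e s) - extend (\<lambda>_. 0) (pt e t)\<bar>"
    using st l_pos[OF e] by (simp add: v abs_mult flip: right_diff_distrib)
  also have "\<dots> \<le> lipschitz_distance (pt e s) (pt e t)"
    using c R by (rule lipschitz_distance_ge)
  finally show "lipschitz_distance (pt e s) (pt e t) = l e * \<bar>s - t\<bar>"
    using R e st by (intro antisym lipschitz_distance_le edge_lipschitzD) auto
qed

text \<open>
  Maximality: for any competing distance \<open>d\<close> the function \<open>d P\<close> is itself 1-Lipschitz along edges, by the
  triangle inequality at midpoints, so it is one of the functions in the supremum.
\<close>

lemma half_edge_distance_le:
  assumes "half_edge_distance G bar l d"
  shows "d \<le> lipschitz_distance"
proof (intro le_funI)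
  fix P Q
  interpret M: Metric_space R d using assms by (simp add: half_edge_distance_def)
  show "d P Q \<le> lipschitz_distance P Q"
  proof (cases "P \<in> R \<and> Q \<in> R")
    case False
    then show ?thesis using assms by (auto simp: half_edge_distance_def lipschitz_distance_def)
  next
    case True
    have half: "d (pt e s) (pt e t) = l e * \<bar>s - t\<bar>"
      if "e \<in> arcs G" "0 \<le> s" "s \<le> 1/2" "0 \<le> t" "t \<le> 1/2" for e s t
      using assms that by (auto simp: half_edge_distance_def)
    have flip: "pt (bar e) (1 - s) = pt e s" if "e \<in> arcs G" for e s
      using that by (auto simp: edge_point_def insert_commute)
    have half': "d (pt e s) (pt e t) = l e * \<bar>s - t\<bar>"
      if "e \<in> arcs G" "s \<le> 1" "1/2 \<le> s" "t \<le> 1" "1/2 \<le> t" for e s t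
      using half[of "bar e" "1 - s" "1 - t"] flip[of e s] flip[of e t] that
      by (simp add: l_bar abs_minus_commute)
    have le: "d (pt e s) (pt e t) \<le> l e * \<bar>s - t\<bar>"
      if e: "e \<in> arcs G" "0 \<le> s" "s \<le> t" "t \<le> 1" for e s t
    proof -
      consider "t \<le> 1/2" | "1/2 \<le> s" | "s \<le> 1/2" "1/2 \<le> t" by linarith
      then show ?thesis
      proof cases
        case 3
        have "d (pt e s) (pt e t) \<le> d (pt e s) (pt e (1/2)) + d (pt e (1/2)) (pt e t)"
          using that by (intro M.triangle pt_in_R) auto
        also have "\<dots> = l e * (1/2 - s) + l e * (t - 1/2)"
          using half[of e s "1/2"] half'[of e "1/2" t] that 3 by simp
        also have "\<dots> = l e * \<bar>s - t\<bar>" using that by (simp add: algebra_simps)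
        finally show ?thesis .
      qed (use half half' that in auto)
    qed
    have "edge_lipschitz (d P)"
      unfolding edge_lipschitz_def
    proof (intro ballI)
      fix e s t assume e: "e \<in> arcs G" and st: "s \<in> {0..1::real}" "t \<in> {0..1::real}"
      have "\<bar>d P (pt e s) - d P (pt e t)\<bar> \<le> d (pt e s) (pt e t)"
        using M.mdist_reverse_triangle[of "pt e s" P "pt e t"] True e st M.commute
        by (metis atLeastAtMost_iff pt_in_R)
      also have "\<dots> \<le> l e * \<bar>s - t\<bar>"
        using le[OF e, of s t] le[OF e, of t s] st M.commute
        by (metis abs_minus_commute atLeastAtMost_iff linear)
      finally show "\<bar>d P (pt e s) - d P (pt e t)\<bar> \<le> l e * \<bar>s - t\<bar>" .
    qed
    then show ?thesis using lipschitz_distance_ge[of "d P" P Q] True by simp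
  qed
qed

lemma length_distance_eq: "length_distance G bar l = lipschitz_distance"
  unfolding length_distance_def
  by (intro Greatest_equality half_edge_lipschitz half_edge_distance_le)

lemma edge_length_length_distance:
  assumes "e \<in> arcs G"
  shows "edge_length G bar (length_distance G bar l) e = l e"
proof -
  have "\<forall>s\<in>{0..1/2}. \<forall>t\<in>{0..1/2}. lipschitz_distance (pt e s) (pt e t) = l e * \<bar>s - t\<bar>"
    using half_edge_lipschitz assms unfolding half_edge_distance_def by blast
  from bspec[OF bspec[OF this, of 0], of "1/2"] show ?thesis
    by (simp add: edge_length_def length_distance_eq)
qed

lemma mball_eq:
  "Metric_space.mball R (length_distance G bar l) (Vertex v) r =
     {Q. Vertex v \<in> R \<and> Q \<in> R \<and> lipschitz_distance (Vertex v) Q < r}"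
proof -
  interpret M: Metric_space R lipschitz_distance by (rule metric_space_lipschitz)
  show ?thesis by (simp add: length_distance_eq M.mball_def)
qed

lemma distance_walk_le:
  assumes "awalk u p v" "e \<in> arcs G" "v = tail G e" "0 \<le> s" "s \<le> 1"
  shows "lipschitz_distance (Vertex u) (pt e s) \<le> wlen p + l e"
proof (rule lipschitz_distance_le)
  show "\<bar>f (Vertex u) - f (pt e s)\<bar> \<le> wlen p + l e" if "edge_lipschitz f" for f
    using edge_lipschitz_walk[OF that assms(1)] edge_lipschitz_tail[OF that assms(2,4,5)] assms(3)
    by simp
qed (use assms in \<open>auto intro!: Vertex_in_R pt_in_R\<close>)

text \<open>
  The combinatorial distance from \<open>u\<close>, extended to the edges, is 1-Lipschitz along edges, so the
  length distance is at least as large; a point closer than \<open>r\<close> must therefore lie on an edge with an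
  end that a walk of length less than \<open>r\<close> reaches.
\<close>

lemma walk_of_distance_less:
  assumes u: "u \<in> verts G" and e: "e \<in> arcs G" and s: "0 \<le> s" "s \<le> 1"
    and less: "lipschitz_distance (Vertex u) (pt e s) < r"
  shows "\<exists>p v. awalk u p v \<and> wlen p < r \<and> (v = tail G e \<or> v = head G e)"
proof -
  define g where "g v = Inf (wlen ` {p. awalk u p v})" for v
  have bdd: "bdd_below (wlen ` {p. awalk u p v})" for v
    by (intro bdd_belowI[of _ 0]) (auto intro!: wlen_nonneg)
  have ne: "wlen ` {p. awalk u p v} \<noteq> {}" if "v \<in> verts G" for v
    using obtain_walk[OF u that] by auto
  have g_le: "g v \<le> wlen p" if "awalk u p v" for p v
    unfolding g_def using that by (intro cInf_lower bdd) auto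
  have step: "g (head G e) \<le> g (tail G e) + l e" if e: "e \<in> arcs G" for e
  proof -
    have "g (head G e) - l e \<le> g (tail G e)"
      unfolding g_def[of "tail G e"]
    proof (rule cInf_greatest)
      fix x assume "x \<in> wlen ` {p. awalk u p (tail G e)}"
      then obtain p where p: "awalk u p (tail G e)" "x = wlen p" by auto
      then have "awalk u (p @ [e]) (head G e)" using e by (simp add: awalk_simps)
      then show "g (head G e) - l e \<le> x" using g_le[of "p @ [e]" "head G e"] p by simp
    qed (use ne e in auto)
    then show ?thesis by simp
  qed
  have lip: "\<bar>g (tail G e) - g (head G e)\<bar> \<le> l e" if "e \<in> arcs G" for e
    using step[OF that] step[of "bar e"] that by (simp add: l_bar abs_le_iff)
  have "g u = 0"
  proof (rule antisym)
    show "g u \<le> 0" using g_le[of "[]" u] u by (simp add: awalk_Nil_iff)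
    show "0 \<le> g u" unfolding g_def using ne[OF u] by (intro cInf_greatest) (auto intro!: wlen_nonneg)
  qed
  then have "extend g (pt e s) < r"
    using lipschitz_distance_ge[OF edge_lipschitz_extend[OF lip], of "Vertex u" "pt e s"] less e s u
    by (simp add: Vertex_in_R pt_in_R)
  then have "min (g (tail G e)) (g (head G e)) < r"
    using extend_pt[OF e s lip[OF e]] l_pos[OF e] s
    by (smt (verit) mult_nonneg_nonneg)
  then obtain v where v: "v = tail G e \<or> v = head G e" "g v < r" by (metis min_def)
  then have "v \<in> verts G" using e by auto
  then obtain p where "awalk u p v" "wlen p < r"
    using cInf_lessD[OF ne, of v r] v unfolding g_def by auto
  then show ?thesis using v by blast
qed

end

section \<open>Reduced walks and balls\<close>

context bidirected_digraph
begin

lemma awalk_reverse: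
  assumes "awalk u p v"
  shows "awalk v (rev (map arev p)) u"
  using assms
proof (induction p arbitrary: u)
  case Nil
  then show ?case by (auto simp: awalk_Nil_iff)
next
  case (Cons e p)
  then have e: "e \<in> arcs G" "u = tail G e" and "awalk v (rev (map arev p)) (head G e)"
    by (auto simp: awalk_Cons_iff)
  moreover have "awalk (head G e) [arev e] u" using e by (simp add: awalk_simps)
  ultimately show ?case by (auto intro: awalk_appendI)
qed

lemma reduced_reverse: "reduced arev (rev (map arev p)) \<longleftrightarrow> reduced arev p"
  unfolding reduced_def successively_rev successively_map
  by (intro successively_cong) (auto simp: eq_commute[of _ "arev _"] arev_eq_iff)

lemma awalk_snoc_iff:
  "awalk u (p @ [e]) v \<longleftrightarrow> awalk u p (tail G e) \<and> e \<in> arcs G \<and> v = head G e"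
proof (induction p arbitrary: u)
  case (Cons a p)
  then show ?case by (auto simp: awalk_Cons_iff)
qed (auto simp: awalk_simps)

text \<open>
  Two distinct reduced walks with common ends, after cancelling their common final edges, form a
  nontrivial reduced closed walk.
\<close>

lemma reduced_awalk_unique:
  assumes no_circuit: "\<And>v p. awalk v p v \<Longrightarrow> reduced arev p \<Longrightarrow> p = []"
    and "awalk u p v" "reduced arev p" "awalk u q v" "reduced arev q"
  shows "p = q"
  using assms(2-)
proof (induction p arbitrary: v q rule: rev_induct)
  case Nil
  then show ?case using no_circuit by (auto simp: awalk_Nil_iff)
next
  case (snoc a p)
  show ?case
  proof (cases q rule: rev_cases)
    case Nil
    then have "v = u" using snoc.prems(3) by (simp add: awalk_Nil_iff)
    then show ?thesis using snoc.prems(1,2) no_circuit by (metis snoc_eq_iff_butlast)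
  next
    case (snoc q' b)
    show ?thesis
    proof (cases "a = b")
      case True
      then have "p = q'"
        using snoc.prems snoc
        by (intro snoc.IH[of "tail G a"])
          (auto simp: awalk_snoc_iff reduced_def successively_append_iff)
      then show ?thesis using True snoc by simp
    next
      case False
      have "awalk u ((p @ [a]) @ rev (map arev q)) u"
        using snoc.prems awalk_reverse by (blast intro: awalk_appendI)
      moreover have "reduced arev ((p @ [a]) @ rev (map arev q))"
        using snoc.prems reduced_reverse[of q] False snoc
        unfolding reduced_def successively_append_iff[of _ "p @ [a]"]
        by (auto simp: arev_eq_iff)
      ultimately show ?thesis using no_circuit by blast
    qed
  qed
qed

end

lemma not_successivelyD:
  "\<not> successively P xs \<Longrightarrow> \<exists>ys a b zs. xs = ys @ a # b # zs \<and> \<not> P a b"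
proof (induction P xs rule: successively.induct)
  case (3 P x y xs)
  show ?case
  proof (cases "P x y")
    case True
    then obtain ys a b zs where "y # xs = ys @ a # b # zs" "\<not> P a b" using 3 by auto
    then have "x # y # xs = (x # ys) @ a # b # zs \<and> \<not> P a b" by simp
    then show ?thesis by blast
  next
    case False
    then have "x # y # xs = [] @ x # y # xs \<and> \<not> P x y" by simp
    then show ?thesis by blast
  qed
qed simp_all

context metric_graph
begin

text \<open>
  Cancelling a backtrack \<open>a, bar a\<close> shortens a walk, so reduced walks suffice to reach every point of
  a ball.
\<close>

lemma reduce_awalk:
  assumes "awalk u p v"
  shows "\<exists>q. awalk u q v \<and> reduced bar q \<and> wlen q \<le> wlen p"
  using assms
proof (induction "length p" arbitrary: p rule: less_induct)
  case less
  show ?case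
  proof (cases "reduced bar p")
    case True
    then show ?thesis using less.prems by blast
  next
    case False
    then obtain xs a b ys where p: "p = xs @ a # b # ys" and b: "b = bar a"
      unfolding reduced_def using not_successivelyD by blast
    have w: "awalk u xs (awlast u xs)" "a \<in> arcs G" "awlast u xs = tail G a" "awalk (tail G a) ys v"
      using less.prems unfolding p b by (auto simp: awalk_Cons_iff)
    then have "awalk u (xs @ ys) v" by (metis awalk_appendI)
    from less.hyps[OF _ this] obtain q
      where "awalk u q v" "reduced bar q" "wlen q \<le> wlen (xs @ ys)"
      by (auto simp: p)
    moreover have "wlen (xs @ ys) \<le> wlen p"
      using w(2) l_pos[of a] by (simp add: p b l_bar)
    ultimately show ?thesis by force
  qed
qed

end

locale locally_finite_metric_graph = metric_graph +
  fixes L :: real and K :: nat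
  assumes L_nonneg: "0 \<le> L"
    and l_le: "e \<in> arcs G \<Longrightarrow> l e \<le> L"
    and finite_out: "finite (out_arcs G v)"
    and card_out_arcs_le: "card (out_arcs G v) \<le> K"
begin

lemma finite_walks_length: "finite {p. (\<exists>v. awalk u p v) \<and> length p = n}"
proof (induction n arbitrary: u)
  case 0
  have "{p. (\<exists>v. awalk u p v) \<and> length p = 0} \<subseteq> {[]}" by auto
  then show ?case using finite_subset by blast
next
  case (Suc n)
  have "{p. (\<exists>v. awalk u p v) \<and> length p = Suc n}
      \<subseteq> (\<Union>e\<in>out_arcs G u. (#) e ` {p. (\<exists>v. awalk (head G e) p v) \<and> length p = n})"
  proof
    fix p assume "p \<in> {p. (\<exists>v. awalk u p v) \<and> length p = Suc n}"
    then obtain e q v where "p = e # q" "length q = n" "e \<in> out_arcs G u" "awalk (head G e) q v"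
      by (auto simp: length_Suc_conv awalk_Cons_iff)
    then show "p \<in> (\<Union>e\<in>out_arcs G u. (#) e ` {p. (\<exists>v. awalk (head G e) p v) \<and> length p = n})"
      by blast
  qed
  moreover have "finite \<dots>" using Suc.IH finite_out by blast
  ultimately show ?case using finite_subset by blast
qed

definition reduced_walks :: "'a \<Rightarrow> real \<Rightarrow> 'b list set" where
  "reduced_walks u r = {p. reduced bar p \<and> (\<exists>v. awalk u p v) \<and> wlen p < r}"

lemma length_less_if_wlen_less:
  assumes "set p \<subseteq> arcs G" "wlen p < r"
  shows "length p < nat \<lceil>r / m\<rceil>"
proof -
  have "m * length p < r" using wlen_ge[OF assms(1)] assms(2) by linarith
  then have "length p < r / m" using m_pos by (simp add: field_simps)
  then show ?thesis by linarith
qed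

lemma finite_reduced_walks: "finite (reduced_walks u r)"
proof -
  have "reduced_walks u r \<subseteq> (\<Union>n<nat \<lceil>r / m\<rceil>. {p. (\<exists>v. awalk u p v) \<and> length p = n})"
  proof
    fix p assume "p \<in> reduced_walks u r"
    then obtain v where p: "awalk u p v" "wlen p < r" by (auto simp: reduced_walks_def)
    then have "length p < nat \<lceil>r / m\<rceil>" by (intro length_less_if_wlen_less) auto
    then show "p \<in> (\<Union>n<nat \<lceil>r / m\<rceil>. {p. (\<exists>v. awalk u p v) \<and> length p = n})"
      using p(1) by blast
  qed
  moreover have "finite \<dots>" using finite_walks_length by blast
  ultimately show ?thesis using finite_subset by blast
qed

definition ball_part :: "'a \<Rightarrow> real \<Rightarrow> 'b \<Rightarrow> real" where
  "ball_part u r e = measure lborel {t \<in> {0..l e}. pt e (t / l e) \<in>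
     Metric_space.mball R (length_distance G bar l) (Vertex u) r}"

lemma measure_lborel_le: "A \<subseteq> {0..c} \<Longrightarrow> 0 \<le> c \<Longrightarrow> measure lborel A \<le> (c::real)"
  using measure_mono_fmeasurable[of A "{0..c}" lborel] measure_notin_sets[of A lborel]
  by (cases "A \<in> sets lborel") (auto simp: fmeasurableI)

lemma ball_part_bounds:
  assumes "e \<in> arcs G"
  shows "0 \<le> ball_part u r e" "ball_part u r e \<le> L"
proof -
  show "0 \<le> ball_part u r e" by (simp add: ball_part_def)
  have "ball_part u r e \<le> l e"
    unfolding ball_part_def using l_pos[OF assms] by (intro measure_lborel_le) auto
  then show "ball_part u r e \<le> L" using l_le[OF assms] by linarith
qed

text \<open>
  Only edges with an end reached by a reduced walk of length less than \<open>r\<close> meet the ball of radius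
  \<open>r\<close>. Choosing such a walk and one of at most \<open>K\<close> edges at its end, in one of two orientations, gives
  the count.
\<close>

lemma ball_support:
  assumes u: "u \<in> verts G"
  shows "\<exists>F. finite F \<and> F \<subseteq> arcs G \<and> card F \<le> 2 * K * card (reduced_walks u r) \<and>
    (\<forall>e\<in>arcs G - F. ball_part u r e = 0)"
proof -
  let ?W = "reduced_walks u r"
  define E where "E = (\<Union>p\<in>?W. out_arcs G (awlast u p))"
  have fin: "finite E" unfolding E_def using finite_reduced_walks finite_out by blast
  have E_arcs: "E \<subseteq> arcs G" by (auto simp: E_def)
  have "card E \<le> (\<Sum>p\<in>?W. card (out_arcs G (awlast u p)))"
    unfolding E_def by (rule card_UN_le[OF finite_reduced_walks])
  also have "\<dots> \<le> (\<Sum>p\<in>?W. K)" by (intro sum_mono card_out_arcs_le)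
  finally have "card E \<le> K * card ?W" by (simp add: mult.commute)
  moreover have "card (E \<union> bar ` E) \<le> card E + card E"
    using card_Un_le[of E "bar ` E"] card_image_le[OF fin, of bar] by linarith
  ultimately have card: "card (E \<union> bar ` E) \<le> 2 * K * card ?W" by simp
  have zero: "ball_part u r e = 0" if e: "e \<in> arcs G - (E \<union> bar ` E)" for e
  proof -
  have no: "\<not> (\<exists>p\<in>?W. awalk u p v)" if "v = tail G e \<or> v = head G e" for v
  proof
    assume "\<exists>p\<in>?W. awalk u p v"
    then obtain p where p: "p \<in> ?W" "awlast u p = v" by auto
    then have "e \<in> E \<or> bar e \<in> E" using that e by (force simp: E_def)
    then show False using e by (metis Diff_iff Un_iff arev_arev imageI)
  qed
  have "pt e s \<notin> Metric_space.mball R (length_distance G bar l) (Vertex u) r"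
    if s: "0 \<le> s" "s \<le> 1" for s
  proof
    assume "pt e s \<in> Metric_space.mball R (length_distance G bar l) (Vertex u) r"
    then have "lipschitz_distance (Vertex u) (pt e s) < r" by (simp add: mball_eq)
    then obtain p v where p: "awalk u p v" "wlen p < r" "v = tail G e \<or> v = head G e"
      using walk_of_distance_less[OF u _ s] e by blast
    obtain q where "awalk u q v" "reduced bar q" "wlen q \<le> wlen p"
      using reduce_awalk[OF p(1)] by blast
    then have "q \<in> reduced_walks u r" using p(2) by (auto simp: reduced_walks_def)
    then show False using no[OF p(3)] \<open>awalk u q v\<close> by blast
  qed
  then have "{t \<in> {0..l e}. pt e (t / l e) \<in>
     Metric_space.mball R (length_distance G bar l) (Vertex u) r} = {}"
    using l_pos[of e] e by (auto simp: divide_le_eq_1)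
  then show ?thesis by (simp only: ball_part_def measure_empty)
  qed
  show ?thesis
  proof (intro exI conjI ballI)
    show "finite (E \<union> bar ` E)" using fin by simp
    show "E \<union> bar ` E \<subseteq> arcs G" using E_arcs by auto
  qed (rule card, rule zero)
qed

lemma ball_length_eq_sum:
  assumes "finite F" "F \<subseteq> arcs G" "\<forall>e\<in>arcs G - F. ball_part u r e = 0"
  shows "ball_length G bar l u r = (\<Sum>e\<in>F. ball_part u r e) / 2"
proof -
  have "infsum (ball_part u r) (arcs G) = infsum (ball_part u r) F"
    using assms by (intro infsum_cong_neutral) auto
  then show ?thesis
    using assms(1) unfolding ball_length_def total_length_def ball_part_def by simp
qed

lemma ball_length_le:
  assumes u: "u \<in> verts G"
  shows "ball_length G bar l u r \<le> K * L * card (reduced_walks u r)"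
proof -
  obtain F where F: "finite F" "F \<subseteq> arcs G" "card F \<le> 2 * K * card (reduced_walks u r)"
    "\<forall>e\<in>arcs G - F. ball_part u r e = 0"
    using ball_support[OF u] by blast
  have "(\<Sum>e\<in>F. ball_part u r e) \<le> (\<Sum>e\<in>F. L)"
    using F(2) ball_part_bounds by (intro sum_mono) auto
  also have "\<dots> = card F * L" by simp
  also have "\<dots> \<le> real (2 * K * card (reduced_walks u r)) * L"
    using F(3) L_nonneg by (intro mult_right_mono) (auto simp del: of_nat_mult)
  finally show ?thesis
    using ball_length_eq_sum[OF F(1,2), of u r] F(4) by (simp add: mult_ac)
qed

lemma ball_length_nonneg:
  assumes u: "u \<in> verts G"
  shows "0 \<le> ball_length G bar l u r"
proof -
  obtain F where F: "finite F" "F \<subseteq> arcs G" "card F \<le> 2 * K * card (reduced_walks u r)"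
    "\<forall>e\<in>arcs G - F. ball_part u r e = 0"
    using ball_support[OF u] by blast
  show ?thesis unfolding ball_length_eq_sum[OF F(1,2,4)] using F(2) ball_part_bounds
    by (intro divide_nonneg_nonneg sum_nonneg) auto
qed

text \<open>
  In a tree, a nonempty reduced walk from \<open>y\<close> is determined by its last edge, and short walks end in
  edges that lie entirely in the ball. The ball is centred at \<open>u\<close> and the walks start at \<open>y\<close>: changing
  the base point costs only the constant \<open>wlen w\<close>.
\<close>

lemma card_walks_le_ball_length:
  assumes no_circuit: "\<And>v p. awalk v p v \<Longrightarrow> reduced bar p \<Longrightarrow> p = []"
    and w: "awalk u w y"
    and Q: "finite Q" "\<And>p. p \<in> Q \<Longrightarrow> p \<noteq> [] \<and> reduced bar p \<and> (\<exists>v. awalk y p v) \<and> wlen p \<le> r"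
    and r': "wlen w + r < r'"
  shows "m * card Q \<le> 2 * ball_length G bar l u r'"
proof -
  have u: "u \<in> verts G" using w by auto
  have snoc: "awalk y (butlast p) (tail G (last p)) \<and> last p \<in> arcs G \<and> awalk y p (head G (last p))
      \<and> wlen p = wlen (butlast p) + l (last p)" if p: "p \<in> Q" for p
  proof -
    obtain p' e where "p = p' @ [e]" using Q(2)[OF p] by (cases p rule: rev_cases) auto
    then show ?thesis using Q(2)[OF p] by (auto simp: awalk_snoc_iff simp del: awalk_append_iff)
  qed
  have inj: "inj_on last Q"
  proof
    fix p q assume "p \<in> Q" "q \<in> Q" "last p = last q"
    then show "p = q"
      using snoc[of p] snoc[of q] Q(2) by (intro reduced_awalk_unique[OF no_circuit]) auto
  qed
  obtain F where F: "finite F" "F \<subseteq> arcs G" "card F \<le> 2 * K * card (reduced_walks u r')"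
    "\<forall>e\<in>arcs G - F. ball_part u r' e = 0"
    using ball_support[OF u] by blast
  have full: "m \<le> ball_part u r' (last p)" if p: "p \<in> Q" for p
  proof -
    let ?e = "last p"
    have e: "?e \<in> arcs G" using snoc[OF p] by simp
    have "pt ?e s \<in> Metric_space.mball R (length_distance G bar l) (Vertex u) r'"
      if s: "0 \<le> s" "s \<le> 1" for s
    proof -
      have "awalk u (w @ butlast p) (tail G ?e)" using snoc[OF p] w by (blast intro: awalk_appendI)
      from distance_walk_le[OF this e refl s]
      have "lipschitz_distance (Vertex u) (pt ?e s) \<le> wlen w + wlen p"
        using snoc[OF p] by simp
      then have "lipschitz_distance (Vertex u) (pt ?e s) < r'" using Q(2)[OF p] r' by linarith
      then show ?thesis using Vertex_in_R[OF u] pt_in_R[OF e s] by (simp add: mball_eq)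
    qed
    then have "{t \<in> {0..l ?e}. pt ?e (t / l ?e) \<in>
      Metric_space.mball R (length_distance G bar l) (Vertex u) r'} = {0..l ?e}"
      using l_pos[OF e] by (auto simp: divide_le_eq_1)
    then have "ball_part u r' ?e = measure lborel {0..l ?e}" by (simp only: ball_part_def)
    then show ?thesis using m_le[OF e] l_pos[OF e] by simp
  qed
  have sub: "last ` Q \<subseteq> F"
  proof
    fix e assume "e \<in> last ` Q"
    then have "e \<in> arcs G" "ball_part u r' e \<noteq> 0" using snoc full m_pos by fastforce+
    then show "e \<in> F" using F(4) by blast
  qed
  have "m * card Q = (\<Sum>p\<in>Q. m)" by simp
  also have "\<dots> \<le> (\<Sum>p\<in>Q. ball_part u r' (last p))" by (intro sum_mono full)
  also have "\<dots> = (\<Sum>e\<in>last ` Q. ball_part u r' e)" by (simp add: sum.reindex[OF inj])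
  also have "\<dots> \<le> (\<Sum>e\<in>F. ball_part u r' e)"
    using F(1,2) sub ball_part_bounds by (intro sum_mono2) auto
  finally show ?thesis unfolding ball_length_eq_sum[OF F(1,2,4)] by simp
qed

end

section \<open>Poincare series and growth of balls\<close>

text \<open>
  \<open>walk_sum G bar l s n e\<close> is the sum of \<open>exp (- s * length)\<close> over the reduced walks of \<open>n\<close> edges that
  continue \<open>e\<close>. Its sum over \<open>n\<close> is the Poincare series, which converges above the entropy and
  diverges below it. The recursion only sees which edges follow which, hence it can be
  evaluated on a tree or on the finite graph it covers.
\<close>

definition successors :: "('a, 'b) pre_digraph \<Rightarrow> ('b \<Rightarrow> 'b) \<Rightarrow> 'b \<Rightarrow> 'b set" where
  "successors G bar e = out_arcs G (head G e) - {bar e}"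

primrec walk_sum ::
  "('a, 'b) pre_digraph \<Rightarrow> ('b \<Rightarrow> 'b) \<Rightarrow> ('b \<Rightarrow> real) \<Rightarrow> real \<Rightarrow> nat \<Rightarrow> 'b \<Rightarrow> real" where
  "walk_sum G bar l s 0 e = 1"
| "walk_sum G bar l s (Suc n) e =
     (\<Sum>f\<in>successors G bar e. exp (- s * l f) * walk_sum G bar l s n f)"

lemma walk_sum_nonneg: "0 \<le> walk_sum G bar l s n e"
  by (induction n arbitrary: e) (auto intro!: sum_nonneg)

text \<open>
  A convergent Poincare series \<open>z\<close> satisfies \<open>z e = 1 + (\<Sum>f. exp (- s * l f) * z f)\<close>. Being a supersolution of the
  transfer operator is all that is needed of a Perron eigenvector here, and it is available
  without any spectral theory.
\<close>

lemma supersolution: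
  assumes sub: "\<And>e f. e \<in> A \<Longrightarrow> f \<in> successors G bar e \<Longrightarrow> f \<in> A"
    and bounded: "\<And>e. e \<in> A \<Longrightarrow> \<exists>C. \<forall>N. (\<Sum>n<N. walk_sum G bar l s n e) \<le> C"
  obtains z where "\<And>e. e \<in> A \<Longrightarrow> 0 < z e"
    "\<And>e. e \<in> A \<Longrightarrow> (\<Sum>f\<in>successors G bar e. exp (- s * l f) * z f) \<le> z e"
proof
  let ?z = "\<lambda>e. \<Sum>n. walk_sum G bar l s n e"
  have summ: "summable (\<lambda>n. walk_sum G bar l s n e)" if e: "e \<in> A" for e
  proof -
    obtain C where C: "\<forall>N. (\<Sum>n<N. walk_sum G bar l s n e) \<le> C" using bounded[OF e] by blast
    show ?thesis
    proof (rule bounded_imp_summable)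
      show "0 \<le> walk_sum G bar l s n e" for n by (rule walk_sum_nonneg)
      show "(\<Sum>n\<le>N. walk_sum G bar l s n e) \<le> C" for N
        using C[rule_format, of "Suc N"] by (simp add: lessThan_Suc_atMost)
    qed
  qed
  have eq: "?z e = 1 + (\<Sum>f\<in>successors G bar e. exp (- s * l f) * ?z f)" if e: "e \<in> A" for e
  proof -
    have "?z e = 1 + (\<Sum>n. walk_sum G bar l s (Suc n) e)"
      using suminf_split_head[OF summ[OF e]] by simp
    also have "(\<Sum>n. walk_sum G bar l s (Suc n) e)
        = (\<Sum>f\<in>successors G bar e. \<Sum>n. exp (- s * l f) * walk_sum G bar l s n f)"
      unfolding walk_sum.simps
      by (intro suminf_sum summable_mult summ) (rule sub[OF e])
    also have "\<dots> = (\<Sum>f\<in>successors G bar e. exp (- s * l f) * ?z f)"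
      by (intro sum.cong refl suminf_mult summ) (rule sub[OF e])
    finally show ?thesis .
  qed
  show "(\<Sum>f\<in>successors G bar e. exp (- s * l f) * ?z f) \<le> ?z e" if "e \<in> A" for e
    using eq[OF that] by linarith
  show "0 < ?z e" if e: "e \<in> A" for e
  proof -
    have "0 \<le> ?z f" if "f \<in> A" for f using summ[OF that] walk_sum_nonneg by (intro suminf_nonneg) auto
    then have "0 \<le> (\<Sum>f\<in>successors G bar e. exp (- s * l f) * ?z f)"
      using sub[OF e] by (intro sum_nonneg mult_nonneg_nonneg) auto
    then show ?thesis using eq[OF e] by linarith
  qed
qed

text \<open>
  An exponential bound on a counting function makes the corresponding Dirichlet sum converge to
  the right of the exponent, uniformly in the finite set; the proof groups the points by \<open>\<lfloor>\<delta> p\<rfloor>\<close>.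
\<close>

lemma sum_exp_le:
  fixes \<delta> :: "'x \<Rightarrow> real"
  assumes fin: "finite Q" and nonneg: "\<And>p. p \<in> Q \<Longrightarrow> 0 \<le> \<delta> p"
    and card: "\<And>r. 0 \<le> r \<Longrightarrow> card {p \<in> Q. \<delta> p \<le> r} \<le> C * exp (t * r)"
    and ts: "t < s" "0 \<le> s" and C: "0 \<le> C"
  shows "(\<Sum>p\<in>Q. exp (- s * \<delta> p)) \<le> C * exp t / (1 - exp (t - s))"
proof -
  obtain J where J: "\<And>p. p \<in> Q \<Longrightarrow> nat \<lfloor>\<delta> p\<rfloor> < J"
    using finite_imageI[OF fin, of "\<lambda>p. nat \<lfloor>\<delta> p\<rfloor>"] unfolding finite_nat_set_iff_bounded by blast
  let ?g = "\<lambda>p j. if \<delta> p \<le> real j + 1 then exp (- s * real j) else 0"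
  have "(\<Sum>p\<in>Q. exp (- s * \<delta> p)) \<le> (\<Sum>p\<in>Q. \<Sum>j<J. ?g p j)"
  proof (rule sum_mono)
    fix p assume p: "p \<in> Q"
    let ?j = "nat \<lfloor>\<delta> p\<rfloor>"
    have j: "real ?j \<le> \<delta> p" "\<delta> p \<le> real ?j + 1" using nonneg[OF p] by linarith+
    have "exp (- s * \<delta> p) \<le> exp (- s * real ?j)" using ts j(1) by (simp add: mult_left_mono)
    also have "\<dots> = ?g p ?j" using j(2) by simp
    also have "\<dots> \<le> (\<Sum>j<J. ?g p j)"
      using J[OF p] by (intro member_le_sum[where f = "?g p"]) auto
    finally show "exp (- s * \<delta> p) \<le> (\<Sum>j<J. ?g p j)" .
  qed
  also have "\<dots> = (\<Sum>j<J. \<Sum>p\<in>Q. ?g p j)" by (rule sum.swap)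
  also have "\<dots> \<le> (\<Sum>j<J. C * exp t * exp (t - s) ^ j)"
  proof (rule sum_mono)
    fix j
    have "(\<Sum>p\<in>Q. ?g p j) = (\<Sum>p\<in>{p \<in> Q. \<delta> p \<le> real j + 1}. exp (- s * real j))"
      by (rule sum.inter_filter[OF fin, symmetric])
    also have "\<dots> = card {p \<in> Q. \<delta> p \<le> real j + 1} * exp (- s * real j)" by simp
    also have "\<dots> \<le> C * exp (t * (real j + 1)) * exp (- s * real j)"
      by (intro mult_right_mono card) auto
    also have "\<dots> = C * exp t * exp (t - s) ^ j"
      by (simp add: algebra_simps flip: exp_add exp_of_nat_mult)
    finally show "(\<Sum>p\<in>Q. ?g p j) \<le> C * exp t * exp (t - s) ^ j" .
  qed
  also have "\<dots> = C * exp t * ((1 - exp (t - s) ^ J) / (1 - exp (t - s)))"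
    using ts(1) unfolding sum_distrib_left[symmetric] sum_gp_strict by simp
  also have "\<dots> \<le> C * exp t * (1 / (1 - exp (t - s)))"
    using C ts(1) by (intro mult_left_mono divide_right_mono) auto
  finally show ?thesis by simp
qed

context locally_finite_metric_graph
begin

definition extensions :: "nat \<Rightarrow> 'b \<Rightarrow> 'b list set" where
  "extensions n a = {p. length p = n \<and> reduced bar (a # p) \<and> (\<exists>v. awalk (head G a) p v)}"

lemma finite_extensions: "finite (extensions n a)"
  by (rule finite_subset[OF _ finite_walks_length[of "head G a" n]]) (auto simp: extensions_def)

lemma extensions_Suc:
  "extensions (Suc n) a = (\<Union>f\<in>successors G bar a. (#) f ` extensions n f)"
proof (intro equalityI subsetI)
  fix p assume "p \<in> extensions (Suc n) a"
  then obtain f q v where "p = f # q" "length q = n" "f \<noteq> bar a" "reduced bar (f # q)"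
      "f \<in> arcs G" "tail G f = head G a" "awalk (head G f) q v"
    by (auto simp: extensions_def length_Suc_conv awalk_Cons_iff reduced_def)
  then show "p \<in> (\<Union>f\<in>successors G bar a. (#) f ` extensions n f)"
    unfolding successors_def extensions_def
    by (intro UN_I[of f] image_eqI[of _ _ q]) auto
next
  fix p assume "p \<in> (\<Union>f\<in>successors G bar a. (#) f ` extensions n f)"
  then show "p \<in> extensions (Suc n) a"
    by (auto simp: successors_def extensions_def awalk_Cons_iff reduced_def)
qed

lemma walk_sum_eq:
  assumes "a \<in> arcs G"
  shows "walk_sum G bar l s n a = (\<Sum>p\<in>extensions n a. exp (- s * wlen p))"
  using assms
proof (induction n arbitrary: a)
  case 0
  then have "extensions 0 a = {[]}" by (auto simp: extensions_def reduced_def awalk_Nil_iff)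
  then show ?case by simp
next
  case (Suc n)
  have "(\<Sum>p\<in>extensions (Suc n) a. exp (- s * wlen p))
      = (\<Sum>f\<in>successors G bar a. \<Sum>p\<in>(#) f ` extensions n f. exp (- s * wlen p))"
    unfolding extensions_Suc
    by (rule sum.UNION_disjoint)
      (auto simp: successors_def finite_out finite_extensions)
  also have "\<dots> = (\<Sum>f\<in>successors G bar a. exp (- s * l f) * walk_sum G bar l s n f)"
  proof (rule sum.cong[OF refl])
    fix f assume "f \<in> successors G bar a"
    then have f: "f \<in> arcs G" by (simp add: successors_def)
    have "(\<Sum>p\<in>(#) f ` extensions n f. exp (- s * wlen p))
        = (\<Sum>p\<in>extensions n f. exp (- s * l f) * exp (- s * wlen p))"
      by (simp add: sum.reindex algebra_simps flip: exp_add)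
    then show "(\<Sum>p\<in>(#) f ` extensions n f. exp (- s * wlen p))
        = exp (- s * l f) * walk_sum G bar l s n f"
      by (simp add: Suc.IH[OF f] sum_distrib_left)
  qed
  finally show ?case by simp
qed

lemma sum_walk_sum:
  assumes "a \<in> arcs G"
  shows "(\<Sum>n<N. walk_sum G bar l s n a) = (\<Sum>p\<in>(\<Union>n<N. extensions n a). exp (- s * wlen p))"
proof -
  have "(\<Sum>p\<in>(\<Union>n<N. extensions n a). exp (- s * wlen p))
      = (\<Sum>n<N. \<Sum>p\<in>extensions n a. exp (- s * wlen p))"
    by (rule sum.UNION_disjoint) (auto simp: finite_extensions, auto simp: extensions_def)
  then show ?thesis by (simp add: walk_sum_eq[OF assms])
qed

text \<open>
  Each walk shorter than \<open>r\<close> contributes at least \<open>exp (- s * r)\<close> to the Poincare series.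
\<close>

lemma card_reduced_walks_le:
  fixes s C :: real
  assumes s: "0 \<le> s" and C: "0 \<le> C"
    and bounded: "\<And>a N. a \<in> arcs G \<Longrightarrow> (\<Sum>n<N. walk_sum G bar l s n a) \<le> C"
  shows "card (reduced_walks u r) \<le> (1 + K * C) * exp (s * r)"
proof -
  define N where "N = nat \<lceil>r / m\<rceil>"
  define E where "E a = (#) a ` (\<Union>n<N. extensions n a)" for a
  let ?w = "\<lambda>p. exp (- s * wlen p)"
  have finE: "finite (E a)" for a unfolding E_def using finite_extensions by blast
  have sub: "reduced_walks u r \<subseteq> insert [] (\<Union>a\<in>out_arcs G u. E a)"
  proof
    fix p assume p: "p \<in> reduced_walks u r"
    show "p \<in> insert [] (\<Union>a\<in>out_arcs G u. E a)"
    proof (cases p)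
      case (Cons a q)
      obtain v where v: "awalk u p v" "wlen p < r" "reduced bar p"
        using p by (auto simp: reduced_walks_def)
      then have "length p < N" unfolding N_def by (intro length_less_if_wlen_less) auto
      then have "length q < N" using Cons by simp
      moreover have "q \<in> extensions (length q) a" "a \<in> out_arcs G u"
        using v unfolding Cons by (auto simp: extensions_def awalk_Cons_iff)
      ultimately show ?thesis unfolding Cons E_def by blast
    qed simp
  qed
  have sumE: "(\<Sum>p\<in>E a. ?w p) \<le> C" if a: "a \<in> arcs G" for a
  proof -
    have "(\<Sum>p\<in>E a. ?w p) = (\<Sum>q\<in>(\<Union>n<N. extensions n a). exp (- s * l a) * exp (- s * wlen q))"
      unfolding E_def by (simp add: sum.reindex algebra_simps flip: exp_add)
    also have "\<dots> = exp (- s * l a) * (\<Sum>n<N. walk_sum G bar l s n a)"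
      by (simp add: sum_walk_sum[OF a] sum_distrib_left)
    also have "\<dots> \<le> 1 * C"
      using s l_pos[OF a] bounded[OF a]
      by (intro mult_mono sum_nonneg walk_sum_nonneg) auto
    finally show ?thesis by simp
  qed
  have "card (reduced_walks u r) * exp (- s * r) = (\<Sum>p\<in>reduced_walks u r. exp (- s * r))" by simp
  also have "\<dots> \<le> (\<Sum>p\<in>reduced_walks u r. ?w p)"
    using s by (intro sum_mono) (auto simp: reduced_walks_def intro: mult_left_mono)
  also have "\<dots> \<le> (\<Sum>p\<in>insert [] (\<Union>a\<in>out_arcs G u. E a). ?w p)"
    using sub finE finite_out by (intro sum_mono2) auto
  also have "\<dots> = 1 + (\<Sum>p\<in>(\<Union>a\<in>out_arcs G u. E a). ?w p)"
    using finE finite_out by (subst sum.insert) (auto simp: E_def)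
  also have "(\<Sum>p\<in>(\<Union>a\<in>out_arcs G u. E a). ?w p) = (\<Sum>a\<in>out_arcs G u. \<Sum>p\<in>E a. ?w p)"
    using finE finite_out by (intro sum.UNION_disjoint) (auto simp: E_def)
  also have "\<dots> \<le> (\<Sum>a\<in>out_arcs G u. C)" by (intro sum_mono sumE) simp
  also have "\<dots> \<le> K * C" using C card_out_arcs_le by (simp add: mult_right_mono)
  finally have "card (reduced_walks u r) * exp (- s * r) \<le> 1 + K * C" by simp
  then show ?thesis by (simp add: exp_minus field_simps)
qed

lemma entropy_le:
  fixes s C :: real
  assumes u: "u \<in> verts G" and s: "0 \<le> s" and C: "0 \<le> C"
    and bounded: "\<And>a N. a \<in> arcs G \<Longrightarrow> (\<Sum>n<N. walk_sum G bar l s n a) \<le> C"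
  shows "Limsup at_top (\<lambda>r. ereal (ln (ball_length G bar l u r) / r)) \<le> ereal s"
proof -
  define D where "D = max 1 (K * L * (1 + K * C))"
  have D: "1 \<le> D" "K * L * (1 + K * C) \<le> D" by (auto simp: D_def)
  have bound: "ln (ball_length G bar l u r) / r \<le> ln D / r + s" if r: "0 < r" for r
  proof -
    let ?b = "ball_length G bar l u r"
    have "?b \<le> K * L * card (reduced_walks u r)" by (rule ball_length_le[OF u])
    also have "\<dots> \<le> K * L * ((1 + K * C) * exp (s * r))"
      using L_nonneg card_reduced_walks_le[OF s C bounded] by (intro mult_left_mono) auto
    also have "\<dots> \<le> D * exp (s * r)" using mult_right_mono[OF D(2), of "exp (s * r)"] by simp
    finally have b: "?b \<le> D * exp (s * r)" .
    have "ln ?b \<le> ln D + s * r"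
    proof (cases "?b = 0")
      case True
      then show ?thesis using D(1) s r by simp
    next
      case False
      then have "0 < ?b" using ball_length_nonneg[OF u, of r] by linarith
      then have "ln ?b \<le> ln (D * exp (s * r))" using b by simp
      also have "\<dots> = ln D + s * r" using D(1) by (simp add: ln_mult)
      finally show ?thesis .
    qed
    then have "ln ?b / r \<le> (ln D + s * r) / r" using r by (simp add: divide_right_mono)
    then show ?thesis using r by (simp add: add_divide_distrib)
  qed
  have "((\<lambda>r. ln D / r + s) \<longlongrightarrow> 0 + s) at_top"
    by (intro tendsto_intros tendsto_divide_0[OF tendsto_const] filterlim_at_top_imp_at_infinity filterlim_ident)
  then have "((\<lambda>r. ereal (ln D / r + s)) \<longlongrightarrow> ereal s) at_top" by simp
  then have "Limsup at_top (\<lambda>r. ereal (ln D / r + s)) = ereal s"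
    by (intro lim_imp_Limsup) auto
  moreover have "Limsup at_top (\<lambda>r. ereal (ln (ball_length G bar l u r) / r))
      \<le> Limsup at_top (\<lambda>r. ereal (ln D / r + s))"
    by (intro Limsup_mono eventually_mono[OF eventually_gt_at_top[of "0::real"]]) (simp add: bound)
  ultimately show ?thesis by simp
qed

text \<open>
  Conversely, growth of balls around one vertex controls the Poincare series issuing from every
  edge, in both of its orientations: for the edges pointing towards \<open>u\<close> this uses the counting
  of walks from a base point other than the centre of the ball.
\<close>

lemma walk_sum_bounded:
  assumes no_circuit: "\<And>v p. awalk v p v \<Longrightarrow> reduced bar p \<Longrightarrow> p = []"
    and u: "u \<in> verts G" and s: "0 \<le> s"
    and less: "Limsup at_top (\<lambda>r. ereal (ln (ball_length G bar l u r) / r)) < ereal s"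
    and a: "a \<in> arcs G"
  shows "\<exists>C. \<forall>N. (\<Sum>n<N. walk_sum G bar l s n a) \<le> C"
proof -
  obtain t where t: "Limsup at_top (\<lambda>r. ereal (ln (ball_length G bar l u r) / r)) < ereal t" "t < s"
    using ereal_dense2[OF less] by auto
  have "\<forall>\<^sub>F r in at_top. ereal (ln (ball_length G bar l u r) / r) < ereal t"
    using Limsup_lessD[OF t(1)] .
  then have "\<forall>\<^sub>F r in at_top. ln (ball_length G bar l u r) / r < t" by simp
  then obtain r0 where r0: "\<And>r. r0 \<le> r \<Longrightarrow> ln (ball_length G bar l u r) / r < t"
    by (auto simp: eventually_at_top_linorder)
  obtain w where w: "awalk u w (tail G a)" using obtain_walk[OF u tail_in_verts[OF a]] .
  define D where "D = max (wlen w + 1) (max r0 1)"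
  have D: "wlen w < D" "r0 \<le> D" "0 < D" by (auto simp: D_def)
  have ball: "ball_length G bar l u r \<le> exp (t * r)" if "D \<le> r" for r
  proof (cases "ball_length G bar l u r = 0")
    case False
    then have pos: "0 < ball_length G bar l u r" using ball_length_nonneg[OF u, of r] by linarith
    have "ln (ball_length G bar l u r) < t * r"
      using r0[of r] that D by (simp add: field_simps)
    then show ?thesis using pos by (metis exp_le_cancel_iff exp_ln less_imp_le)
  qed simp
  let ?C = "2 / m * exp (t * D)"
  let ?B = "?C * exp t / (1 - exp (t - s))"
  have "(\<Sum>n<N. walk_sum G bar l s n a) \<le> exp (s * l a) * ?B" for N
  proof -
    define Q where "Q = (#) a ` (\<Union>n<N. extensions n a)"
    have finQ: "finite Q" unfolding Q_def using finite_extensions by blast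
    have Q: "p \<noteq> [] \<and> reduced bar p \<and> (\<exists>v. awalk (tail G a) p v)" if "p \<in> Q" for p
      using that a by (auto simp: Q_def extensions_def awalk_Cons_iff)
    have "(\<Sum>p\<in>Q. exp (- s * wlen p)) \<le> ?B"
    proof (rule sum_exp_le[OF finQ _ _ t(2) s])
      show "0 \<le> wlen p" if "p \<in> Q" for p using Q[OF that] by (auto intro!: wlen_nonneg)
      show "card {p \<in> Q. wlen p \<le> r} \<le> ?C * exp (t * r)" if r: "0 \<le> r" for r
      proof -
        have "m * card {p \<in> Q. wlen p \<le> r} \<le> 2 * ball_length G bar l u (D + r)"
          using Q finQ D(1) by (intro card_walks_le_ball_length[OF no_circuit w]) auto
        also have "\<dots> \<le> 2 * exp (t * (D + r))" using ball[of "D + r"] r by simp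
        finally show ?thesis using m_pos by (simp add: field_simps exp_add)
      qed
      show "0 \<le> ?C" using m_pos by simp
    qed
    moreover have "(\<Sum>p\<in>Q. exp (- s * wlen p)) = exp (- s * l a) * (\<Sum>n<N. walk_sum G bar l s n a)"
      unfolding Q_def sum_walk_sum[OF a] sum_distrib_left
      by (simp add: sum.reindex algebra_simps flip: exp_add)
    ultimately have "exp (- s * l a) * (\<Sum>n<N. walk_sum G bar l s n a) \<le> ?B" by simp
    then have "exp (s * l a) * (exp (- s * l a) * (\<Sum>n<N. walk_sum G bar l s n a)) \<le> exp (s * l a) * ?B"
      by (rule mult_left_mono) simp
    then show ?thesis by (simp add: mult.assoc[symmetric] flip: exp_add)
  qed
  then show ?thesis by blast
qed

end

text \<open>
  A covering is bijective on the edges leaving a vertex and maps reversals to reversals, hence it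
  is bijective on successors.
\<close>

lemma walk_sum_covering:
  assumes "bidirected_digraph T barT" and cover: "graph_covering T barT X barX pv pe"
    and l: "\<And>a. a \<in> arcs T \<Longrightarrow> lT a = l (pe a)" and "a \<in> arcs T"
  shows "walk_sum T barT lT s n a = walk_sum X barX l s n (pe a)"
  using assms(4)
proof (induction n arbitrary: a)
  case (Suc n)
  interpret T: bidirected_digraph T barT by (rule assms(1))
  have a: "barT a \<in> out_arcs T (head T a)" "pe (barT a) = barX (pe a)"
      "head X (pe a) = pv (head T a)" "head T a \<in> verts T"
    using cover Suc.prems unfolding graph_covering_def by auto
  then have bij: "bij_betw pe (out_arcs T (head T a)) (out_arcs X (head X (pe a)))"
    using cover unfolding graph_covering_def by auto
  have "bij_betw pe (successors T barT a) (successors X barX (pe a))"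
    unfolding successors_def
  proof (rule bij_betw_DiffI[OF bij])
    show "bij_betw pe {barT a} {barX (pe a)}" using a(2) by (simp add: bij_betw_def)
    show "{barX (pe a)} \<subseteq> out_arcs X (head X (pe a))"
      using bij a(1,2) bij_betwE by fastforce
  qed (use a in auto)
  then have "(\<Sum>b\<in>successors T barT a. exp (- s * l (pe b)) * walk_sum X barX l s n (pe b))
      = (\<Sum>f\<in>successors X barX (pe a). exp (- s * l f) * walk_sum X barX l s n f)"
    by (rule sum.reindex_bij_betw)
  moreover have "(\<Sum>b\<in>successors T barT a. exp (- s * lT b) * walk_sum T barT lT s n b)
      = (\<Sum>b\<in>successors T barT a. exp (- s * l (pe b)) * walk_sum X barX l s n (pe b))"
    by (intro sum.cong refl) (auto simp: successors_def l Suc.IH)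
  ultimately show ?case by simp
qed simp

section \<open>The entropy inequality on a finite graph\<close>

lemma excess_nonneg: "0 \<le> exp t - 1 - (t::real)"
  using exp_ge_add_one_self[of t] by linarith

text \<open>
  Quantitative strict convexity: \<open>exp t - 1 - t\<close> is at least \<open>t\<^sup>2 / 4\<close> for \<open>t \<ge> - 2\<close>, and exceeds \<open>1\<close> below.
\<close>

lemma excess_tendsto_imp:
  fixes b :: "nat \<Rightarrow> real"
  assumes "(\<lambda>n. exp (b n) - 1 - b n) \<longlonglongrightarrow> 0"
  shows "b \<longlonglongrightarrow> 0"
proof -
  have low: "t\<^sup>2 / 4 \<le> exp t - 1 - t" if "- 2 \<le> t" for t :: real
  proof -
    have "(1 + t / 2)\<^sup>2 \<le> (exp (t / 2))\<^sup>2"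
      using that exp_ge_add_one_self[of "t / 2"] by (intro power_mono) auto
    also have "\<dots> = exp t" by (simp flip: exp_double)
    finally show ?thesis by (simp add: power2_eq_square algebra_simps)
  qed
  have ev: "\<forall>\<^sub>F n in sequentially. exp (b n) - 1 - b n < 1"
    using order_tendstoD(2)[OF assms, of 1] by simp
  have "(\<lambda>n. (b n)\<^sup>2) \<longlonglongrightarrow> 0"
  proof (rule tendsto_sandwich[of "\<lambda>_. 0" _ _ "\<lambda>n. 4 * (exp (b n) - 1 - b n)"])
    show "\<forall>\<^sub>F n in sequentially. (b n)\<^sup>2 \<le> 4 * (exp (b n) - 1 - b n)"
      using ev
    proof eventually_elim
      case (elim n)
      have "- 2 \<le> b n" using elim exp_gt_zero[of "b n"] by linarith
      then show ?case using low[of "b n"] by simp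
    qed
    show "(\<lambda>n. 4 * (exp (b n) - 1 - b n)) \<longlonglongrightarrow> 0" using tendsto_mult_left[OF assms, of 4] by simp
  qed auto
  from tendsto_real_sqrt[OF this] have "(\<lambda>n. \<bar>b n\<bar>) \<longlonglongrightarrow> 0" by simp
  then show ?thesis by (rule tendsto_rabs_zero_cancel)
qed

locale valency_graph = bidirected_digraph X bar + fin_digraph X
  for X :: "('a, 'b) pre_digraph" and bar :: "'b \<Rightarrow> 'b" +
  fixes k :: "'a \<Rightarrow> nat"
  assumes valency: "x \<in> verts X \<Longrightarrow> card (out_arcs X x) = k x + 1"
    and k_ge: "x \<in> verts X \<Longrightarrow> 2 \<le> k x"
begin

lemma card_successors:
  assumes "e \<in> arcs X"
  shows "card (successors X bar e) = k (head X e)"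
proof -
  have "bar e \<in> out_arcs X (head X e)" using assms by simp
  then show ?thesis
    using assms by (simp add: successors_def card_Diff_singleton valency)
qed

lemma finite_successors: "finite (successors X bar e)"
  by (auto simp: successors_def)

lemma sum_arcs_tail: "(\<Sum>e\<in>arcs X. g (tail X e)) = (\<Sum>x\<in>verts X. real (k x + 1) * g x)"
proof -
  have "(\<Sum>e\<in>arcs X. g (tail X e)) = (\<Sum>x\<in>verts X. \<Sum>e\<in>{e\<in>arcs X. tail X e = x}. g (tail X e))"
    by (rule sum.group[symmetric]) auto
  also have "\<dots> = (\<Sum>x\<in>verts X. real (k x + 1) * g x)"
  proof (rule sum.cong[OF refl])
    fix x assume x: "x \<in> verts X"
    have "(\<Sum>e\<in>{e\<in>arcs X. tail X e = x}. g (tail X e)) = (\<Sum>e\<in>out_arcs X x. g x)"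
      by (rule sum.cong) (auto simp: out_arcs_def)
    then show "(\<Sum>e\<in>{e\<in>arcs X. tail X e = x}. g (tail X e)) = real (k x + 1) * g x"
      using valency[OF x] by simp
  qed
  finally show ?thesis .
qed

lemma sum_arcs_bar: "(\<Sum>e\<in>arcs X. g (bar e)) = (\<Sum>e\<in>arcs X. g e)"
  by (rule sum.reindex_bij_betw) (use arev_permutes_arcs permutes_imp_bij in blast)

text \<open>
  The non-backtracking random walk moves from \<open>e\<close> to each of its \<open>k (head X e)\<close> successors with equal
  probability. As every edge also has \<open>k (tail X f)\<close> predecessors, the uniform measure on oriented
  edges is stationary.
\<close>

lemma sum_successors:
  "(\<Sum>e\<in>arcs X. (\<Sum>f\<in>successors X bar e. g f) / k (head X e)) = (\<Sum>f\<in>arcs X. (g f :: real))"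
proof -
  have swap: "f \<in> successors X bar e \<longleftrightarrow> bar e \<in> successors X bar (bar f)"
    if "e \<in> arcs X" "f \<in> arcs X" for e f
    using that by (auto simp: successors_def)
  have "(\<Sum>e\<in>arcs X. (\<Sum>f\<in>successors X bar e. g f) / k (head X e))
      = (\<Sum>e\<in>arcs X. \<Sum>f\<in>arcs X. if f \<in> successors X bar e then g f / k (tail X f) else 0)"
  proof (rule sum.cong[OF refl])
    fix e assume "e \<in> arcs X"
    have "(\<Sum>f\<in>arcs X. if f \<in> successors X bar e then g f / k (tail X f) else 0)
        = (\<Sum>f\<in>successors X bar e. g f / k (tail X f))"
      by (intro sum.mono_neutral_cong_right) (auto simp: successors_def)
    also have "\<dots> = (\<Sum>f\<in>successors X bar e. g f / k (head X e))"
      by (intro sum.cong) (auto simp: successors_def)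
    finally show "(\<Sum>f\<in>successors X bar e. g f) / k (head X e)
        = (\<Sum>f\<in>arcs X. if f \<in> successors X bar e then g f / k (tail X f) else 0)"
      by (simp add: sum_divide_distrib)
  qed
  also have "\<dots> = (\<Sum>f\<in>arcs X. \<Sum>e\<in>arcs X. if f \<in> successors X bar e then g f / k (tail X f) else 0)"
    by (rule sum.swap)
  also have "\<dots> = (\<Sum>f\<in>arcs X. g f)"
  proof (rule sum.cong[OF refl])
    fix f assume f: "f \<in> arcs X"
    have "(\<Sum>e\<in>arcs X. if f \<in> successors X bar e then g f / k (tail X f) else 0)
        = (\<Sum>e\<in>arcs X. if bar e \<in> successors X bar (bar f) then g f / k (tail X f) else 0)"
      by (intro sum.cong if_cong swap f refl)
    also have "\<dots> = (\<Sum>e\<in>arcs X. if e \<in> successors X bar (bar f) then g f / k (tail X f) else 0)"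
      by (rule sum_arcs_bar)
    also have "\<dots> = (\<Sum>e\<in>successors X bar (bar f). g f / k (tail X f))"
      by (intro sum.mono_neutral_cong_right) (auto simp: successors_def)
    also have "\<dots> = g f"
      using card_successors[of "bar f"] f k_ge[of "tail X f"] by simp
    finally show "(\<Sum>e\<in>arcs X. if f \<in> successors X bar e then g f / k (tail X f) else 0) = g f" .
  qed
  finally show ?thesis .
qed

abbreviation S :: real where
  "S \<equiv> (\<Sum>x\<in>verts X. (real (k x) + 1) * ln (real (k x)))"

lemma sum_ln_head: "(\<Sum>e\<in>arcs X. ln (real (k (head X e)))) = S"
proof -
  have "(\<Sum>e\<in>arcs X. ln (real (k (head X e)))) = (\<Sum>e\<in>arcs X. ln (real (k (tail X (bar e)))))"
    by (intro sum.cong) auto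
  also have "\<dots> = (\<Sum>e\<in>arcs X. ln (real (k (tail X e))))"
    by (rule sum_arcs_bar)
  finally show ?thesis using sum_arcs_tail[of "\<lambda>x. ln (real (k x))"] by (simp add: algebra_simps)
qed

text \<open>
  The logarithm of \<open>exp (- s * l f) * z f / z e\<close> relative to the uniform transition probability \<open>1 / k (head X e)\<close>. It
  vanishes identically precisely when the transfer operator, normalized by \<open>z\<close>, is the
  non-backtracking random walk.
\<close>

definition gain :: "('b \<Rightarrow> real) \<Rightarrow> real \<Rightarrow> ('b \<Rightarrow> real) \<Rightarrow> 'b \<Rightarrow> 'b \<Rightarrow> real" where
  "gain l s z e f = ln (k (head X e)) + ln (z f) - s * l f - ln (z e)"

text \<open>
  The supersolution property says that \<open>exp (gain)\<close> has mean at most 1 over the successors of \<open>e\<close>.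
  Averaging \<open>gain\<close> over the stationary measure, the terms \<open>ln (z f) - ln (z e)\<close> telescope and only the volume and
  \<open>S\<close> remain. Since the excess \<open>exp t - 1 - t\<close> is nonnegative, this already forces \<open>s\<close> times the total
  length of all oriented edges to be at least \<open>S\<close>.
\<close>

lemma sum_excess_le:
  fixes z l :: "'b \<Rightarrow> real" and s :: real
  assumes z: "\<And>e. e \<in> arcs X \<Longrightarrow> 0 < z e"
    and super: "\<And>e. e \<in> arcs X \<Longrightarrow> (\<Sum>f\<in>successors X bar e. exp (- s * l f) * z f) \<le> z e"
  shows "(\<Sum>e\<in>arcs X. (\<Sum>f\<in>successors X bar e. exp (gain l s z e f) - 1 - gain l s z e f) / k (head X e))
    \<le> s * (\<Sum>e\<in>arcs X. l e) - S"
proof -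
  let ?k = "\<lambda>e. real (k (head X e))"
  have kpos: "0 < ?k e" if "e \<in> arcs X" for e using k_ge[of "head X e"] that by simp
  have succ: "f \<in> arcs X" if "f \<in> successors X bar e" for e f
    using that by (auto simp: successors_def)
  have one: "(\<Sum>f\<in>successors X bar e. exp (gain l s z e f) - 1 - gain l s z e f) / ?k e
      \<le> ln (z e) - ln (?k e) - (\<Sum>f\<in>successors X bar e. ln (z f) - s * l f) / ?k e"
    if e: "e \<in> arcs X" for e
  proof -
    have "(\<Sum>f\<in>successors X bar e. exp (gain l s z e f)) =
        (\<Sum>f\<in>successors X bar e. ?k e / z e * (exp (- s * l f) * z f))"
      using z[OF e] kpos[OF e] z[OF succ]
      by (intro sum.cong) (auto simp: gain_def exp_diff exp_add exp_minus field_simps)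
    also have "\<dots> = ?k e / z e * (\<Sum>f\<in>successors X bar e. exp (- s * l f) * z f)"
      by (simp add: sum_distrib_left)
    also have "\<dots> \<le> ?k e / z e * z e"
      using super[OF e] kpos[OF e] z[OF e] by (intro mult_left_mono) auto
    also have "\<dots> = ?k e" using z[OF e] by simp
    finally have "(\<Sum>f\<in>successors X bar e. exp (gain l s z e f) - 1) \<le> 0"
      by (simp add: sum_subtractf card_successors[OF e])
    then have "(\<Sum>f\<in>successors X bar e. exp (gain l s z e f) - 1 - gain l s z e f)
        \<le> - (\<Sum>f\<in>successors X bar e. gain l s z e f)"
      by (simp add: sum_subtractf)
    also have "(\<Sum>f\<in>successors X bar e. gain l s z e f)
        = (\<Sum>f\<in>successors X bar e. (ln (?k e) - ln (z e)) + (ln (z f) - s * l f))"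
      by (intro sum.cong) (auto simp: gain_def)
    also have "\<dots> = ?k e * (ln (?k e) - ln (z e)) + (\<Sum>f\<in>successors X bar e. ln (z f) - s * l f)"
      by (simp add: sum.distrib card_successors[OF e])
    finally show ?thesis using kpos[OF e] by (simp add: field_simps)
  qed
  have "(\<Sum>e\<in>arcs X. (\<Sum>f\<in>successors X bar e. exp (gain l s z e f) - 1 - gain l s z e f) / ?k e)
      \<le> (\<Sum>e\<in>arcs X. ln (z e) - ln (?k e) - (\<Sum>f\<in>successors X bar e. ln (z f) - s * l f) / ?k e)"
    by (intro sum_mono one)
  also have "\<dots> = (\<Sum>e\<in>arcs X. ln (z e)) - S - (\<Sum>f\<in>arcs X. ln (z f) - s * l f)"
    using sum_ln_head sum_successors[of "\<lambda>f. ln (z f) - s * l f"]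
    unfolding sum_subtractf[of "\<lambda>e. ln (z e) - ln (?k e)"] sum_subtractf[of "\<lambda>e. ln (z e)" "\<lambda>e. ln (?k e)"]
    by linarith
  also have "\<dots> = s * (\<Sum>e\<in>arcs X. l e) - S"
    by (simp add: sum_subtractf sum_distrib_left)
  finally show ?thesis .
qed

lemma excess_le:
  fixes z l :: "'b \<Rightarrow> real" and s :: real
  assumes z: "\<And>e. e \<in> arcs X \<Longrightarrow> 0 < z e"
    and super: "\<And>e. e \<in> arcs X \<Longrightarrow> (\<Sum>f\<in>successors X bar e. exp (- s * l f) * z f) \<le> z e"
    and e: "e \<in> arcs X" and f: "f \<in> successors X bar e"
  shows "exp (gain l s z e f) - 1 - gain l s z e f \<le> k (head X e) * (s * (\<Sum>e\<in>arcs X. l e) - S)"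
proof -
  have kpos: "0 < real (k (head X e))" using k_ge[of "head X e"] e by simp
  let ?x = "\<lambda>e f. exp (gain l s z e f) - 1 - gain l s z e f"
  have "?x e f \<le> (\<Sum>f\<in>successors X bar e. ?x e f)"
    using f excess_nonneg by (intro member_le_sum finite_successors) auto
  then have "?x e f / k (head X e) \<le> (\<Sum>f\<in>successors X bar e. ?x e f) / k (head X e)"
    using kpos by (simp add: divide_right_mono)
  also have "\<dots> \<le> (\<Sum>e\<in>arcs X. (\<Sum>f\<in>successors X bar e. ?x e f) / k (head X e))"
    using e by (intro member_le_sum[where f = "\<lambda>e. (\<Sum>f\<in>successors X bar e. ?x e f) / k (head X e)"])
      (auto intro!: divide_nonneg_nonneg sum_nonneg excess_nonneg)
  also have "\<dots> \<le> s * (\<Sum>e\<in>arcs X. l e) - S" using z super by (rule sum_excess_le)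
  finally show ?thesis using kpos by (simp add: field_simps)
qed

lemma obtain_successor:
  assumes "e \<in> arcs X"
  obtains f where "f \<in> successors X bar e" "f \<noteq> g"
proof -
  have "\<not> successors X bar e \<subseteq> {g}"
  proof
    assume "successors X bar e \<subseteq> {g}"
    then have "card (successors X bar e) \<le> 1" using card_mono[of "{g}"] by simp
    then show False using card_successors[OF assms] k_ge[of "head X e"] assms by simp
  qed
  then show ?thesis using that by blast
qed

text \<open>
  If supersolutions exist for every \<open>s\<close> above \<open>S / 2\<close>, the total excess tends to 0 as \<open>s\<close> decreases to
  \<open>S / 2\<close>, so every \<open>gain\<close> tends to 0. Because each edge has at least two successors, the unknown
  values of \<open>z\<close> can be eliminated from finitely many gains, which leaves \<open>l f\<close>. Working with limits of gains
  avoids a compactness argument for \<open>z\<close> itself.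
\<close>

lemma equality_case:
  assumes l_bar: "\<And>e. e \<in> arcs X \<Longrightarrow> l (bar e) = l e"
    and vol: "(\<Sum>e\<in>arcs X. l e) = 2"
    and super: "\<And>s. S / 2 < s \<Longrightarrow> \<exists>z. (\<forall>e\<in>arcs X. 0 < z e) \<and>
      (\<forall>e\<in>arcs X. (\<Sum>f\<in>successors X bar e. exp (- s * l f) * z f) \<le> z e)"
    and f: "f \<in> arcs X"
  shows "S * l f = ln (real (k (tail X f)) * real (k (head X f)))"
proof -
  define s where "s n = S / 2 + 1 / real (Suc n)" for n
  have "\<exists>z. \<forall>n. (\<forall>e\<in>arcs X. 0 < z n e) \<and>
      (\<forall>e\<in>arcs X. (\<Sum>f\<in>successors X bar e. exp (- s n * l f) * z n f) \<le> z n e)"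
    by (intro choice allI super) (simp add: s_def)
  then obtain z where z: "\<And>n e. e \<in> arcs X \<Longrightarrow> 0 < z n e"
    "\<And>n e. e \<in> arcs X \<Longrightarrow> (\<Sum>f\<in>successors X bar e. exp (- s n * l f) * z n f) \<le> z n e"
    by metis
  have s_lim: "s \<longlonglongrightarrow> S / 2"
    unfolding s_def using tendsto_add[OF tendsto_const LIMSEQ_inverse_real_of_nat, of "S / 2"]
    by (simp add: inverse_eq_divide)
  have gain_lim: "(\<lambda>n. gain l (s n) (z n) e f) \<longlonglongrightarrow> 0"
    if ef: "e \<in> arcs X" "f \<in> successors X bar e" for e f
  proof (rule excess_tendsto_imp)
    show "(\<lambda>n. exp (gain l (s n) (z n) e f) - 1 - gain l (s n) (z n) e f) \<longlonglongrightarrow> 0"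
    proof (rule tendsto_sandwich[of "\<lambda>_. 0" _ _ "\<lambda>n. k (head X e) * (s n * 2 - S)"])
      show "\<forall>\<^sub>F n in sequentially. exp (gain l (s n) (z n) e f) - 1 - gain l (s n) (z n) e f
          \<le> k (head X e) * (s n * 2 - S)"
        using excess_le[OF z ef] vol by simp
      have "(\<lambda>n. k (head X e) * (s n * 2 - S)) \<longlonglongrightarrow> k (head X e) * (S / 2 * 2 - S)"
        by (intro tendsto_intros s_lim)
      then show "(\<lambda>n. k (head X e) * (s n * 2 - S)) \<longlonglongrightarrow> 0" by simp
    qed (use excess_nonneg in auto)
  qed
  \<comment> \<open>The gains of \<open>bar e0 \<rightarrow> f\<close> and \<open>bar g0 \<rightarrow> bar f\<close> contain \<open>l f\<close> twice; comparing the two ways of entering \<open>e1\<close>,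
    and likewise \<open>g1\<close>, cancels the values of \<open>z\<close>.\<close>
  have f': "bar f \<in> arcs X" using f by simp
  obtain e0 where e0: "e0 \<in> successors X bar (bar f)" using obtain_successor[OF f'] by blast
  obtain e1 where e1: "e1 \<in> successors X bar (bar f)" "e1 \<noteq> e0" using obtain_successor[OF f'] by blast
  obtain g0 where g0: "g0 \<in> successors X bar f" using obtain_successor[OF f] by blast
  obtain g1 where g1: "g1 \<in> successors X bar f" "g1 \<noteq> g0" using obtain_successor[OF f] by blast
  have a: "e0 \<in> arcs X" "g0 \<in> arcs X" "head X (bar e0) = tail X f" "head X (bar g0) = head X f"
    using e0 g0 f by (auto simp: successors_def)
  have mem: "f \<in> successors X bar (bar e0)" "bar f \<in> successors X bar (bar g0)"
      "e1 \<in> successors X bar (bar e0)" "g1 \<in> successors X bar (bar g0)"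
    using e0 e1 g0 g1 f by (auto simp: successors_def)
  let ?b = "\<lambda>n. gain l (s n) (z n)"
  have "(\<lambda>n. ?b n (bar e0) f + ?b n (bar g0) (bar f) - ?b n (bar e0) e1 + ?b n (bar f) e1
      - ?b n (bar g0) g1 + ?b n f g1) \<longlonglongrightarrow> 0 + 0 - 0 + 0 - 0 + 0"
    by (intro tendsto_intros gain_lim) (use a mem e1 g1 f in auto)
  moreover have "?b n (bar e0) f + ?b n (bar g0) (bar f) - ?b n (bar e0) e1 + ?b n (bar f) e1
      - ?b n (bar g0) g1 + ?b n f g1 = ln (k (tail X f)) + ln (k (head X f)) - 2 * s n * l f" for n
    using a f l_bar[OF f] by (simp add: gain_def algebra_simps)
  ultimately have "(\<lambda>n. ln (k (tail X f)) + ln (k (head X f)) - 2 * s n * l f) \<longlonglongrightarrow> 0" by simp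
  moreover have "(\<lambda>n. ln (k (tail X f)) + ln (k (head X f)) - 2 * s n * l f)
      \<longlonglongrightarrow> ln (k (tail X f)) + ln (k (head X f)) - 2 * (S / 2) * l f"
    by (intro tendsto_intros s_lim)
  ultimately have "ln (k (tail X f)) + ln (k (head X f)) - 2 * (S / 2) * l f = 0"
    using LIMSEQ_unique by blast
  moreover have "0 < k (tail X f)" "0 < k (head X f)"
    using k_ge[of "tail X f"] k_ge[of "head X f"] f by auto
  ultimately show ?thesis by (simp add: ln_mult)
qed

text \<open>
  For the optimal lengths, \<open>exp (- (S / 2) * l f)\<close> equals \<open>1 / sqrt (k (tail X f) * k (head X f))\<close>, and \<open>sqrt (k (head X e))\<close> is an exact
  eigenvector of the transfer operator at \<open>S / 2\<close> with eigenvalue 1. Any larger \<open>s\<close> gains a factor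
  \<open>exp (- (s - S / 2) * m)\<close> at every step.
\<close>

lemma optimal_walk_sum_le:
  assumes l: "\<And>e. e \<in> arcs X \<Longrightarrow> S * l e = ln (real (k (tail X e)) * real (k (head X e)))"
    and m: "\<And>e. e \<in> arcs X \<Longrightarrow> m \<le> l e"
    and s: "S / 2 \<le> s" and e: "e \<in> arcs X"
  shows "walk_sum X bar l s n e \<le> sqrt (k (head X e)) * exp (- (s - S / 2) * m) ^ n"
  using e
proof (induction n arbitrary: e)
  case 0
  then show ?case using k_ge[of "head X e"] by simp
next
  case (Suc n)
  let ?q = "exp (- (s - S / 2) * m)"
  have kpos: "0 < k (head X e)" using k_ge[of "head X e"] Suc.prems by simp
  have "walk_sum X bar l s (Suc n) e
      \<le> (\<Sum>f\<in>successors X bar e. ?q ^ Suc n / sqrt (k (head X e)))"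
    unfolding walk_sum.simps
  proof (rule sum_mono)
    fix f assume "f \<in> successors X bar e"
    then have f: "f \<in> arcs X" "tail X f = head X e" by (auto simp: successors_def)
    have kf: "0 < k (tail X f)" "0 < k (head X f)"
      using k_ge[OF tail_in_verts[OF f(1)]] k_ge[OF head_in_verts[OF f(1)]] by auto
    have "exp (- s * l f) = exp (- (s - S / 2) * l f) * exp (- (S * l f) / 2)"
      by (simp add: field_simps flip: exp_add)
    also have "exp (- (S * l f) / 2) = 1 / (sqrt (k (tail X f)) * sqrt (k (head X f)))"
    proof -
      have "exp (- (S * l f) / 2) = inverse (exp (ln (real (k (tail X f)) * real (k (head X f))) / 2))"
        unfolding l[OF f(1)] by (simp flip: exp_minus)
      also have "ln (real (k (tail X f)) * real (k (head X f))) / 2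
          = ln (sqrt (real (k (tail X f)) * real (k (head X f))))"
        using kf by (simp add: ln_sqrt)
      finally show ?thesis using kf by (simp add: real_sqrt_mult inverse_eq_divide)
    qed
    also have "exp (- (s - S / 2) * l f) * (1 / (sqrt (k (tail X f)) * sqrt (k (head X f))))
        \<le> ?q * (1 / (sqrt (k (tail X f)) * sqrt (k (head X f))))"
      using s m[OF f(1)] by (intro mult_right_mono) (auto intro: mult_left_mono_neg)
    finally have "exp (- s * l f) * walk_sum X bar l s n f
        \<le> (?q * (1 / (sqrt (k (tail X f)) * sqrt (k (head X f))))) * (sqrt (k (head X f)) * ?q ^ n)"
      using Suc.IH[OF f(1)] walk_sum_nonneg by (intro mult_mono) auto
    then show "exp (- s * l f) * walk_sum X bar l s n f \<le> ?q ^ Suc n / sqrt (k (head X e))"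
      using kf f(2) by (simp add: field_simps)
  qed
  also have "\<dots> = k (head X e) / sqrt (k (head X e)) * ?q ^ Suc n"
    using card_successors[OF Suc.prems] by simp
  also have "k (head X e) / sqrt (k (head X e)) = sqrt (k (head X e))"
    by (rule real_div_sqrt) simp
  finally show ?case .
qed

lemma optimal_walk_sum_bounded:
  assumes l: "\<And>e. e \<in> arcs X \<Longrightarrow> S * l e = ln (real (k (tail X e)) * real (k (head X e)))"
    and m: "\<And>e. e \<in> arcs X \<Longrightarrow> m \<le> l e" "0 < m"
    and s: "S / 2 < s"
  shows "\<exists>C. \<forall>e\<in>arcs X. \<forall>N. (\<Sum>n<N. walk_sum X bar l s n e) \<le> C"
proof (intro exI ballI allI)
  fix e N assume e: "e \<in> arcs X"
  let ?q = "exp (- (s - S / 2) * m)"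
  have q: "0 < ?q" "?q < 1" using mult_neg_pos[of "S / 2 - s" m] s m(2) by auto
  have "(\<Sum>n<N. walk_sum X bar l s n e) \<le> (\<Sum>n<N. sqrt (k (head X e)) * ?q ^ n)"
    using optimal_walk_sum_le[OF l m(1) less_imp_le[OF s] e] by (intro sum_mono) blast
  also have "\<dots> = sqrt (k (head X e)) * (\<Sum>n<N. ?q ^ n)" by (simp add: sum_distrib_left)
  also have "(\<Sum>n<N. ?q ^ n) = (1 - ?q ^ N) / (1 - ?q)"
    using q(2) unfolding sum_gp_strict by (metis less_irrefl)
  also have "sqrt (k (head X e)) * \<dots> \<le> sqrt (k (head X e)) * (1 / (1 - ?q))"
    using q by (intro mult_left_mono divide_right_mono) auto
  also have "sqrt (k (head X e)) * (1 / (1 - ?q))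
      \<le> (\<Sum>x\<in>verts X. sqrt (k x)) * (1 / (1 - ?q))"
    using e q by (intro mult_right_mono member_le_sum) auto
  finally show "(\<Sum>n<N. walk_sum X bar l s n e) \<le> (\<Sum>x\<in>verts X. sqrt (k x)) * (1 / (1 - ?q))"
    by simp
qed

end

section \<open>Entropy of normalized length distances\<close>

lemma length_distance_cong:
  assumes "\<And>e. e \<in> arcs G \<Longrightarrow> l e = l' e"
  shows "length_distance G bar l = length_distance G bar l'"
proof -
  have "half_edge_distance G bar l = half_edge_distance G bar l'"
    by (intro ext) (simp add: half_edge_distance_def assms)
  then show ?thesis by (simp add: length_distance_def)
qed

locale universal_cover = valency_graph X bar k
  for X :: "('a, 'b) pre_digraph" and bar :: "'b \<Rightarrow> 'b" and k :: "'a \<Rightarrow> nat" +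
  fixes T :: "('c, 'd) pre_digraph" and barT :: "'d \<Rightarrow> 'd"
    and pv :: "'c \<Rightarrow> 'a" and pe :: "'d \<Rightarrow> 'b" and x0 :: 'c
  assumes connected_base: "Digraph_Component.connected X"
    and covering: "universal_covering_tree T barT X bar pv pe"
    and x0: "x0 \<in> verts T"
begin

definition normalized :: "('b \<Rightarrow> real) \<Rightarrow> bool" where
  "normalized l \<longleftrightarrow> edge_length_system X bar l \<and> volume X l = 1"

abbreviation entropy :: "('b \<Rightarrow> real) \<Rightarrow> ereal" where
  "entropy l \<equiv> volume_entropy X bar T barT pe x0 (length_distance X bar l)"

abbreviation lifted :: "('b \<Rightarrow> real) \<Rightarrow> 'd \<Rightarrow> real" where
  "lifted l a \<equiv> edge_length X bar (length_distance X bar l) (pe a)"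

lemma normalized_sum: "normalized l \<Longrightarrow> (\<Sum>e\<in>arcs X. l e) = 2"
  by (simp add: normalized_def volume_def)

lemma cover_graph: "graph_covering T barT X bar pv pe"
  using covering by (simp add: universal_covering_tree_def)

lemma pe_in_arcs: "a \<in> arcs T \<Longrightarrow> pe a \<in> arcs X"
  using cover_graph by (simp add: graph_covering_def)

lemma tree_digraph: "bidirected_digraph T barT"
  using covering by (simp add: universal_covering_tree_def undirected_tree_def)

lemma tree_no_circuit: "pre_digraph.awalk T v p v \<Longrightarrow> reduced barT p \<Longrightarrow> p = []"
  using covering by (simp add: universal_covering_tree_def undirected_tree_def)

lemma tree_out_arcs: "finite (out_arcs T y) \<and> card (out_arcs T y) \<le> card (arcs X)"
proof (cases "y \<in> verts T")
  case True
  then have bij: "bij_betw pe (out_arcs T y) (out_arcs X (pv y))"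
    using cover_graph by (simp add: graph_covering_def)
  have "card (out_arcs X (pv y)) \<le> card (arcs X)" by (intro card_mono) auto
  then show ?thesis using bij_betw_finite[OF bij] bij_betw_same_card[OF bij] by auto
next
  case False
  interpret T: bidirected_digraph T barT by (rule tree_digraph)
  have "out_arcs T y = {}" using False T.tail_in_verts by (auto simp: out_arcs_def)
  then show ?thesis by simp
qed

lemma metric_structure:
  assumes "normalized l"
  obtains m L where "metric_graph X bar l m" "\<And>a. a \<in> arcs T \<Longrightarrow> lifted l a = l (pe a)"
    "locally_finite_metric_graph T barT (lifted l) m L (card (arcs X))"
proof -
  have ne: "arcs X \<noteq> {}" using normalized_sum[OF assms] by auto
  have l: "0 < l e" "l (bar e) = l e" if "e \<in> arcs X" for e
    using assms that by (auto simp: normalized_def edge_length_system_def)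
  define m where "m = Min (l ` arcs X)"
  define L where "L = Max (l ` arcs X)"
  have m: "0 < m" "m \<le> l e" and L: "l e \<le> L" if "e \<in> arcs X" for e
    using ne l that by (auto simp: m_def L_def)
  have m0: "0 < m" using m(1) ne by blast
  have L0: "0 \<le> L" using L l(1) ne by (meson all_not_in_conv less_imp_le order.trans)
  interpret M: metric_graph X bar l m
    by unfold_locales (use connected_base l m m0 in auto)
  have lift: "lifted l a = l (pe a)" if "a \<in> arcs T" for a
    using pe_in_arcs[OF that] by (rule M.edge_length_length_distance)
  interpret T: bidirected_digraph T barT by (rule tree_digraph)
  have bar: "pe (barT a) = bar (pe a)" if "a \<in> arcs T" for a
    using cover_graph that by (simp add: graph_covering_def)
  have conn: "Digraph_Component.connected T"
    using covering by (simp add: universal_covering_tree_def undirected_tree_def)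
  have "locally_finite_metric_graph T barT (lifted l) m L (card (arcs X))"
    by unfold_locales
      (use conn m0 m L L0 l lift bar pe_in_arcs tree_out_arcs in
        \<open>simp_all add: M.edge_length_length_distance\<close>)
  then show ?thesis using that M.metric_graph_axioms lift by blast
qed

lemma entropy_eq_Limsup:
  "entropy l = Limsup at_top (\<lambda>r. ereal (ln (ball_length T barT (lifted l) x0 r) / r))"
  by (simp add: volume_entropy_def)

text \<open>
  Every edge of \<open>X\<close> lifts to the tree, where the entropy bound makes its Poincare series converge.
\<close>

lemma obtain_supersolution:
  assumes l: "normalized l" and s: "0 \<le> s" and less: "entropy l < ereal s"
  shows "\<exists>z. (\<forall>e\<in>arcs X. 0 < z e) \<and>
    (\<forall>e\<in>arcs X. (\<Sum>f\<in>successors X bar e. exp (- s * l f) * z f) \<le> z e)"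
proof -
  obtain m L where lift: "\<And>a. a \<in> arcs T \<Longrightarrow> lifted l a = l (pe a)"
    and "locally_finite_metric_graph T barT (lifted l) m L (card (arcs X))"
    using metric_structure[OF l] by blast
  then interpret T: locally_finite_metric_graph T barT "lifted l" m L "card (arcs X)" by simp
  have "\<exists>C. \<forall>N. (\<Sum>n<N. walk_sum X bar l s n e) \<le> C" if e: "e \<in> arcs X" for e
  proof -
    have "tail X e \<in> pv ` verts T" using cover_graph e by (simp add: graph_covering_def)
    then obtain y where y: "y \<in> verts T" "pv y = tail X e" by auto
    then have "bij_betw pe (out_arcs T y) (out_arcs X (tail X e))"
      using cover_graph by (auto simp: graph_covering_def)
    then have "e \<in> pe ` out_arcs T y" using e by (simp add: bij_betw_imp_surj_on)
    then obtain a where a: "a \<in> arcs T" "pe a = e" by auto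
    have "\<exists>C. \<forall>N. (\<Sum>n<N. walk_sum T barT (lifted l) s n a) \<le> C"
      using less unfolding entropy_eq_Limsup
      by (intro T.walk_sum_bounded[OF tree_no_circuit x0 s _ a(1)])
    then show ?thesis
      using walk_sum_covering[where l = l and lT = "lifted l", OF tree_digraph cover_graph lift a(1)] a(2) by simp
  qed
  then obtain z where "\<And>e. e \<in> arcs X \<Longrightarrow> 0 < z e"
    "\<And>e. e \<in> arcs X \<Longrightarrow> (\<Sum>f\<in>successors X bar e. exp (- s * l f) * z f) \<le> z e"
    using supersolution[of "arcs X" X bar l s] by (auto simp: successors_def)
  then show ?thesis by blast
qed

lemma S_pos: "0 < S"
proof -
  have "verts X \<noteq> {}"
    using x0 cover_graph by (auto simp: graph_covering_def)
  moreover have "0 < (real (k x) + 1) * ln (real (k x))" if "x \<in> verts X" for x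
    using k_ge[OF that] by (intro mult_pos_pos ln_gt_zero) auto
  ultimately show ?thesis by (intro sum_pos) auto
qed

lemma entropy_ge:
  assumes l: "normalized l"
  shows "ereal (S / 2) \<le> entropy l"
proof (rule ccontr)
  assume "\<not> ereal (S / 2) \<le> entropy l"
  then have "max 0 (entropy l) < ereal (S / 2)" using S_pos by simp
  then obtain s where s: "max 0 (entropy l) < ereal s" "ereal s < ereal (S / 2)"
    using ereal_dense2 by blast
  then have s': "0 \<le> s" "entropy l < ereal s" by auto
  then obtain z where "\<And>e. e \<in> arcs X \<Longrightarrow> 0 < z e"
    "\<And>e. e \<in> arcs X \<Longrightarrow> (\<Sum>f\<in>successors X bar e. exp (- s * l f) * z f) \<le> z e"
    using obtain_supersolution[OF l] by blast
  then have "(\<Sum>e\<in>arcs X. (\<Sum>f\<in>successors X bar e. exp (gain l s z e f) - 1 - gain l s z e f)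
      / k (head X e)) \<le> s * 2 - S"
    using sum_excess_le[where z = z and l = l and s = s] normalized_sum[OF l] by simp
  moreover have "0 \<le> (\<Sum>e\<in>arcs X. (\<Sum>f\<in>successors X bar e. exp (gain l s z e f) - 1 - gain l s z e f)
      / k (head X e))"
    by (intro sum_nonneg divide_nonneg_nonneg excess_nonneg) auto
  ultimately show False using s(2) by simp
qed

lemma minimizer_unique:
  assumes l: "normalized l" and le: "entropy l \<le> ereal (S / 2)" and f: "f \<in> arcs X"
  shows "l f = ln (real (k (tail X f)) * real (k (head X f))) / S"
proof -
  have "S * l f = ln (real (k (tail X f)) * real (k (head X f)))"
  proof (rule equality_case[OF _ normalized_sum[OF l] _ f])
    show "l (bar e) = l e" if "e \<in> arcs X" for e
      using l that by (auto simp: normalized_def edge_length_system_def)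
    show "\<exists>z. (\<forall>e\<in>arcs X. 0 < z e) \<and>
      (\<forall>e\<in>arcs X. (\<Sum>f\<in>successors X bar e. exp (- s * l f) * z f) \<le> z e)" if "S / 2 < s" for s
      using that S_pos le by (intro obtain_supersolution[OF l]) (auto intro: le_less_trans)
  qed
  then show ?thesis using S_pos by (simp add: field_simps)
qed

definition optimal :: "'b \<Rightarrow> real" where
  "optimal e = ln (real (k (tail X e)) * real (k (head X e))) / S"

lemma normalized_optimal: "normalized optimal"
proof -
  have k: "2 \<le> k (tail X e)" "2 \<le> k (head X e)" if "e \<in> arcs X" for e
    using k_ge that by auto
  have split: "optimal e = (ln (k (tail X e)) + ln (k (head X e))) / S" if "e \<in> arcs X" for e
    using k[OF that] unfolding optimal_def by (subst ln_mult) auto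
  have "0 < optimal e" if "e \<in> arcs X" for e
  proof -
    have "0 < ln (real (k (tail X e)))" "0 < ln (real (k (head X e)))"
      using k[OF that] by (auto intro!: ln_gt_zero)
    then show ?thesis using S_pos by (simp add: split[OF that])
  qed
  moreover have "optimal (bar e) = optimal e" if "e \<in> arcs X" for e
    using that by (simp add: optimal_def mult.commute)
  moreover have "(\<Sum>e\<in>arcs X. optimal e) = 2"
  proof -
    have "(\<Sum>e\<in>arcs X. ln (real (k (tail X e)))) = S"
      using sum_arcs_tail[of "\<lambda>x. ln (real (k x))"] by (simp add: algebra_simps)
    moreover have "(\<Sum>e\<in>arcs X. optimal e)
        = ((\<Sum>e\<in>arcs X. ln (real (k (tail X e)))) + (\<Sum>e\<in>arcs X. ln (real (k (head X e))))) / S"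
      by (simp add: split flip: sum_divide_distrib sum.distrib)
    ultimately show ?thesis using sum_ln_head S_pos by simp
  qed
  ultimately show ?thesis by (simp add: normalized_def edge_length_system_def volume_def)
qed

lemma entropy_optimal: "entropy optimal = ereal (S / 2)"
proof (rule antisym)
  show "ereal (S / 2) \<le> entropy optimal" by (rule entropy_ge[OF normalized_optimal])
  obtain m L where m: "metric_graph X bar optimal m"
    and lift: "\<And>a. a \<in> arcs T \<Longrightarrow> lifted optimal a = optimal (pe a)"
    and "locally_finite_metric_graph T barT (lifted optimal) m L (card (arcs X))"
    using metric_structure[OF normalized_optimal] by blast
  then interpret T: locally_finite_metric_graph T barT "lifted optimal" m L "card (arcs X)" by simp
  interpret M: metric_graph X bar optimal m by (rule m)
  have eq: "S * optimal e = ln (real (k (tail X e)) * real (k (head X e)))" for e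
    using S_pos by (simp add: optimal_def)
  have upper: "entropy optimal \<le> ereal s" if s: "S / 2 < s" for s
  proof -
    obtain C where C: "\<forall>e\<in>arcs X. \<forall>N. (\<Sum>n<N. walk_sum X bar optimal s n e) \<le> C"
      using optimal_walk_sum_bounded[OF eq M.m_le M.m_pos s] by blast
    have "(\<Sum>n<N. walk_sum T barT (lifted optimal) s n a) \<le> max 0 C" if a: "a \<in> arcs T" for a N
      using C pe_in_arcs[OF a] walk_sum_covering[where l = optimal and lT = "lifted optimal", OF tree_digraph cover_graph lift a]
      by (simp add: le_max_iff_disj)
    then show ?thesis
      unfolding entropy_eq_Limsup using s S_pos by (intro T.entropy_le[OF x0, where C = "max 0 C"]) auto
  qed
  show "entropy optimal \<le> ereal (S / 2)"
  proof (rule ereal_le_epsilon2)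
    show "entropy optimal \<le> ereal (S / 2) + ereal \<epsilon>" if "0 < \<epsilon>" for \<epsilon>
      using upper[of "S / 2 + \<epsilon>"] that by simp
  qed
qed

lemma is_arg_min_iff:
  "is_arg_min (volume_entropy X bar T barT pe x0) (\<lambda>d. d \<in> normalized_length_distances X bar) d
    \<longleftrightarrow> d = length_distance X bar optimal" (is "?min d \<longleftrightarrow> _")
proof -
  have range: "d \<in> normalized_length_distances X bar \<Longrightarrow>
      \<exists>l. normalized l \<and> d = length_distance X bar l" for d
    by (auto simp: normalized_length_distances_def normalized_def)
  have mem: "length_distance X bar optimal \<in> normalized_length_distances X bar"
    using normalized_optimal unfolding normalized_length_distances_def normalized_def by blast
  show ?thesis
  proof
    assume d: "?min d"
    then have "d \<in> normalized_length_distances X bar" by (simp add: is_arg_min_def)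
    from range[OF this] obtain l where l: "normalized l" "d = length_distance X bar l"
      by (elim exE conjE)
    have "\<not> entropy optimal < entropy l"
      using d mem unfolding is_arg_min_def l(2) by meson
    then have "entropy l \<le> ereal (S / 2)" by (simp add: entropy_optimal)
    from minimizer_unique[OF l(1) this] show "d = length_distance X bar optimal"
      unfolding l(2) by (intro length_distance_cong) (simp add: optimal_def)
  next
    assume d: "d = length_distance X bar optimal"
    have "\<not> volume_entropy X bar T barT pe x0 d' < entropy optimal"
      if d': "d' \<in> normalized_length_distances X bar" for d'
    proof -
      obtain l where l: "normalized l" "d' = length_distance X bar l"
        using range[OF d'] by (elim exE conjE)
      show ?thesis unfolding l(2) using entropy_ge[OF l(1)] by (simp add: entropy_optimal)
    qed
    then show "?min d" unfolding is_arg_min_def d using mem by meson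
  qed
qed

end

theorem mainTheorem1:
  fixes X :: "('a, 'b) pre_digraph" and bar :: "'b \<Rightarrow> 'b" and k :: "'a \<Rightarrow> nat"
    and T :: "('c, 'd) pre_digraph" and barT :: "'d \<Rightarrow> 'd"
    and pv :: "'c \<Rightarrow> 'a" and pe :: "'d \<Rightarrow> 'b" and x0 :: 'c
  assumes "bidirected_digraph X bar" and "fin_digraph X" and "Digraph_Component.connected X"
    and "\<And>x. x \<in> verts X \<Longrightarrow> out_degree X x = k x + 1"
    and "\<And>x. x \<in> verts X \<Longrightarrow> k x + 1 \<ge> 3"
    and "universal_covering_tree T barT X bar pv pe"
    and "x0 \<in> verts T"
  shows "(\<exists>!d. is_arg_min (volume_entropy X bar T barT pe x0)
                 (\<lambda>d. d \<in> normalized_length_distances X bar) d) \<and>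
    (let S = (\<Sum>x\<in>verts X. (real (k x) + 1) * ln (real (k x)));
         d = length_distance X bar
               (\<lambda>e. ln (real (k (tail X e)) * real (k (head X e))) / S)
     in is_arg_min (volume_entropy X bar T barT pe x0)
          (\<lambda>d. d \<in> normalized_length_distances X bar) d \<and>
        volume_entropy X bar T barT pe x0 d = ereal (1 / 2 * S))"
proof -
  interpret bidirected_digraph X bar by (rule assms(1))
  interpret fin_digraph X by (rule assms(2))
  interpret universal_cover X bar k T barT pv pe x0
  proof unfold_locales
    show "card (out_arcs X x) = k x + 1" if "x \<in> verts X" for x
      using assms(4)[OF that] by (simp add: out_degree_def)
    show "2 \<le> k x" if "x \<in> verts X" for x using assms(5)[OF that] by simp
  qed (fact assms)+
  have "(\<lambda>e. ln (real (k (tail X e)) * real (k (head X e))) / S) = optimal"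
    by (rule ext) (simp only: optimal_def)
  then show ?thesis
    unfolding Let_def is_arg_min_iff using entropy_optimal by simp
qed

end
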